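(* Let $\Phi=\{\phi_\ell\}_{\ell=1}^m$ be an affinely irreducible generalized Pisot IFS of type I on $\mathbb{R}^d$. Then for every strictly positive probability vector $\boldsymbol{p}=(p_\ell)_{\ell=1}^m$, the self-affine measure corresponding to $\Phi$ and $\boldsymbol{p}$ is non-Rajchman.
   Context: A homogeneous affine IFS on $\mathbb{R}^d$ ($d\ge 1$) is a finite family $\Phi=\{\phi_\ell(x)=Ax+a_\ell\}_{\ell=1}^m$ with $A\in GL_d(\mathbb{R})$ of spectral radius less than $1$ and $a_\ell\in\mathbb{R}^d$. It is affinely irreducible if there is no proper affine subspace $V$ of $\mathbb{R}^d$ with $\phi_\ell(V)=V$ for all $1\le \ell\le m$. For a probability vector $\boldsymbol{p}=(p_\ell)_{\ell=1}^m$, the associated self-affine measure is the unique Borel probability measure $\mu$ on $\mathbb{R}^d$ with $\mu=\sum_{\ell=1}^m p_\ell\,\mu\circ\phi_\ell^{-1}$. The Fourier transform of a Borel probability measure $\nu$ on $\mathbb{R}^d$ is $\widehat\nu(\xi)=\int e^{2\pi i\langle \xi,x\rangle}\,d\nu(x)$; $\nu$ is Rajchman if $|\widehat\nu(\xi)|\to0$ as $|\xi|\to\infty$, and non-Rajchman otherwise. On $\mathbb{C}^d$, $\langle z,w\rangle=\sum_j z_j\overline{w_j}$. Pisot tuple: a finite collection $\{\beta_1,\dots,\beta_k\}$ of distinct algebraic integers (real or complex) such that (i) $|\beta_j|>1$ for all $j$; (ii) there is a monic $P\in\mathbb{Z}[x]$ with $P(\beta_j)=0$ for all $1\le j\le k$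 such that every other root $z$ of $P$, if any, satisfies $|z|<1$. It is of type I if, taking $P$ of smallest possible degree, $P$ has at least one root in $\{|z|<1\}$. Generalized Pisot IFS of type I: a homogeneous affine IFS $\{Ax+a_\ell\}_{\ell=1}^m$ on $\mathbb{R}^d$ for which there exist $k\ge1$, $\beta_1,\dots,\beta_k\in\mathbb{C}$ and $\zeta_1,\dots,\zeta_k\in\mathbb{C}^d\setminus\{0\}$ such that: (i) $\{\beta_1,\dots,\beta_k\}$ is a Pisot tuple of type I; (ii) $A^{\top}\zeta_j=\beta_j^{-1}\zeta_j$ for $1\le j\le k$; (iii) for every $1\le\ell\le m$ there is $P_\ell\in\mathbb{Z}[x]$ with $\langle\zeta_j,a_\ell-a_1\rangle=P_\ell(\beta_j)$ for all $1\le j\le k$. *)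

theory Defs
  imports "HOL-Probability.Probability" "HOL-Computational_Algebra.Polynomial"
begin

definition complex_mat :: "real^'n^'m \<Rightarrow> complex^'n^'m" where
  "complex_mat A = map_matrix complex_of_real A"

definition complex_vec :: "real^'n \<Rightarrow> complex^'n" where
  "complex_vec x = (\<chi> i. complex_of_real (x $ i))"

text \<open>The library inner product on \<^typ>\<open>complex^'n\<close> is real-valued, hence a separate Hermitian
  one; it is conjugate-linear in the second argument.\<close>

definition herm_inner :: "complex^'n \<Rightarrow> complex^'n \<Rightarrow> complex" where
  "herm_inner z w = (\<Sum>i\<in>UNIV. z $ i * cnj (w $ i))"

definition complex_eigenvalues :: "real^'n^'n \<Rightarrow> complex set" where
  "complex_eigenvalues A = {c. \<exists>v. v \<noteq> 0 \<and> complex_mat A *v v = c *s v}"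

definition mat_spectral_radius :: "real^'n^'n \<Rightarrow> real" where
  "mat_spectral_radius A = (SUP c\<in>complex_eigenvalues A. cmod c)"

text \<open>An IFS \<open>{A x + a\<^sub>l}\<close>, \<open>1 \<le> l \<le> m\<close>, is given by \<open>A\<close>, \<open>a\<close> and \<open>m\<close>; values of \<open>a\<close> outside
  \<open>{1..m}\<close> are irrelevant. The \<open>a\<^sub>l\<close> need not be distinct.\<close>

definition ifs_map :: "real^'n^'n \<Rightarrow> (nat \<Rightarrow> real^'n) \<Rightarrow> nat \<Rightarrow> real^'n \<Rightarrow> real^'n" where
  "ifs_map A a l x = A *v x + a l"

definition homogeneous_affine_IFS :: "real^'n^'n \<Rightarrow> (nat \<Rightarrow> real^'n) \<Rightarrow> nat \<Rightarrow> bool" where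
  "homogeneous_affine_IFS A a m \<longleftrightarrow> m \<ge> 1 \<and> invertible A \<and> mat_spectral_radius A < 1"

text \<open>The predicate \<^const>\<open>affine\<close> holds of the empty set, which is not an affine subspace
  (and is invariant under every IFS).\<close>

definition affinely_irreducible :: "real^'n^'n \<Rightarrow> (nat \<Rightarrow> real^'n) \<Rightarrow> nat \<Rightarrow> bool" where
  "affinely_irreducible A a m \<longleftrightarrow>
     \<not> (\<exists>V. affine V \<and> V \<noteq> {} \<and> V \<noteq> UNIV \<and> (\<forall>l\<in>{1..m}. ifs_map A a l ` V = V))"

definition self_affine_measure ::
  "real^'n^'n \<Rightarrow> (nat \<Rightarrow> real^'n) \<Rightarrow> nat \<Rightarrow> (nat \<Rightarrow> real) \<Rightarrow> (real^'n) measure \<Rightarrow> bool" where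
  "self_affine_measure A a m p \<mu> \<longleftrightarrow>
     prob_space \<mu> \<and> sets \<mu> = sets borel \<and>
     (\<forall>B\<in>sets borel. measure \<mu> B = (\<Sum>l=1..m. p l * measure \<mu> (ifs_map A a l -` B)))"

definition strictly_positive_prob_vector :: "nat \<Rightarrow> (nat \<Rightarrow> real) \<Rightarrow> bool" where
  "strictly_positive_prob_vector m p \<longleftrightarrow> (\<forall>l\<in>{1..m}. p l > 0) \<and> (\<Sum>l=1..m. p l) = 1"

definition fourier_transform :: "(real^'n) measure \<Rightarrow> real^'n \<Rightarrow> complex" where
  "fourier_transform \<nu> \<xi> = (LINT x|\<nu>. exp (2 * complex_of_real pi * \<i> * complex_of_real (\<xi> \<bullet> x)))"

definition rajchman :: "(real^'n) measure \<Rightarrow> bool" where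
  "rajchman \<nu> \<longleftrightarrow> ((\<lambda>\<xi>. cmod (fourier_transform \<nu> \<xi>)) \<longlongrightarrow> 0) at_infinity"

definition int_poly_eval :: "int poly \<Rightarrow> complex \<Rightarrow> complex" where
  "int_poly_eval P z = poly (map_poly of_int P) z"

definition pisot_witness :: "complex set \<Rightarrow> int poly \<Rightarrow> bool" where
  "pisot_witness S P \<longleftrightarrow> lead_coeff P = 1 \<and>
     (\<forall>b\<in>S. int_poly_eval P b = 0) \<and>
     (\<forall>z. int_poly_eval P z = 0 \<and> z \<notin> S \<longrightarrow> cmod z < 1)"

definition pisot_tuple :: "complex set \<Rightarrow> bool" where
  "pisot_tuple S \<longleftrightarrow> finite S \<and> S \<noteq> {} \<and> (\<forall>b\<in>S. algebraic_int b \<and> cmod b > 1) \<and>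
     (\<exists>P. pisot_witness S P)"

text \<open>The witness of smallest degree is unique: it is the product of the distinct minimal
  polynomials of the elements of \<open>S\<close>.\<close>

definition pisot_tuple_type_I :: "complex set \<Rightarrow> bool" where
  "pisot_tuple_type_I S \<longleftrightarrow> pisot_tuple S \<and>
     (\<exists>P. pisot_witness S P \<and> (\<forall>Q. pisot_witness S Q \<longrightarrow> degree P \<le> degree Q) \<and>
          (\<exists>z. int_poly_eval P z = 0 \<and> cmod z < 1))"

text \<open>Injectivity of \<open>\<beta>\<close> says that \<open>\<beta>\<^sub>1, \<dots>, \<beta>\<^sub>k\<close> are distinct, as the members of a Pisot tuple are.\<close>

definition generalized_pisot_IFS_type_I :: "real^'n^'n \<Rightarrow> (nat \<Rightarrow> real^'n) \<Rightarrow> nat \<Rightarrow> bool" where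
  "generalized_pisot_IFS_type_I A a m \<longleftrightarrow> homogeneous_affine_IFS A a m \<and>
     (\<exists>k \<beta> \<zeta>. k \<ge> (1::nat) \<and> inj_on \<beta> {1..k} \<and> (\<forall>j\<in>{1..k}. \<zeta> j \<noteq> 0) \<and>
        pisot_tuple_type_I (\<beta> ` {1..k}) \<and>
        (\<forall>j\<in>{1..k}. complex_mat (transpose A) *v \<zeta> j = inverse (\<beta> j) *s \<zeta> j) \<and>
        (\<forall>l\<in>{1..m}. \<exists>P. \<forall>j\<in>{1..k}.
           herm_inner (\<zeta> j) (complex_vec (a l - a 1)) = int_poly_eval P (\<beta> j)))"

end

theory Submission
  imports Defs "HOL-Computational_Algebra.Computational_Algebra" "HOL-Real_Asymp.Real_Asymp"
begin

text \<open>Let \<open>\<gamma>\<close> be a root of modulus less than 1 of the minimal witness of the Pisot tuple and \<open>G\<close> its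
  minimal polynomial. For \<open>Q \<in> \<int>[x]\<close> let \<open>\<xi>\<^sub>k\<close> be the real part of the sum of
  \<open>\<beta>\<^sup>k Q(\<beta>) \<zeta>\<^sub>\<beta>\<close> over the roots \<open>\<beta>\<close> of \<open>G\<close> outside the unit disc. Then
  \<open>A\<^sup>T \<xi>\<^sub>k = \<xi>\<^sub>k\<^sub>-\<^sub>1\<close>, so the Fourier transform at \<open>\<xi>\<^sub>k\<close> is, up to a unimodular factor, a product over
  \<open>j \<le> k\<close> of the exponential sums \<open>\<Sum>\<^sub>l p\<^sub>l e(\<langle>\<xi>\<^sub>j, a\<^sub>l - a\<^sub>1\<rangle>)\<close>. As power sums of all roots of \<open>G\<close> are
  integers, \<open>\<langle>\<xi>\<^sub>j, a\<^sub>l - a\<^sub>1\<rangle>\<close> is exponentially close to an integer as \<open>\<bar>j\<bar> \<rightarrow> \<infinity>\<close>, so the products stay away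
  from 0 as soon as no factor vanishes.

  To choose \<open>Q\<close>, let its coefficients range over \<open>{1..S}\<close>. Only the factors with \<open>\<bar>j\<bar> = O(log S)\<close> can
  vanish. Because \<open>\<gamma>\<close> exists, distinct frequencies of the \<open>j\<close>-th factor differ by an irrational number in some
  coordinate; a differencing argument then bounds the proportion of \<open>Q\<close> annihilating it by
  \<open>O(S\<^bsup>-e\<^esup>)\<close>. The union bound leaves some \<open>Q\<close> for which no factor vanishes.

  If the measure were Rajchman, then \<open>\<xi>\<^sub>k\<close> would be bounded for \<open>k \<ge> 0\<close>, which forces all
  \<open>\<langle>\<zeta>\<^sub>\<beta>, a\<^sub>l - a\<^sub>1\<rangle>\<close> to vanish and contradicts irreducibility.\<close>

unbundle no fps_syntax

section \<open>Exponential sums on integer boxes\<close>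

definition unit_exp :: "real \<Rightarrow> complex" where
  "unit_exp x = cis (2 * pi * x)"

lemma unit_exp_add: "unit_exp (x + y) = unit_exp x * unit_exp y"
  by (simp add: unit_exp_def cis_mult ring_distribs)

lemma unit_exp_nonzero [simp]: "unit_exp x \<noteq> 0"
  by (simp add: unit_exp_def)

lemma norm_unit_exp [simp]: "norm (unit_exp x) = 1"
  by (simp add: unit_exp_def)

lemma unit_exp_eq_1_iff: "unit_exp x = 1 \<longleftrightarrow> x \<in> \<int>"
proof -
  have "unit_exp x = exp (\<i> * of_real (2*pi*x))"
    by (simp add: unit_exp_def cis_conv_exp)
  moreover have "exp (\<i> * of_real (2*pi*x)) = 1 \<longleftrightarrow> (\<exists>n::int. 2*pi*x = of_int (2*n) * pi)"
    unfolding exp_eq_1 by simp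
  moreover have "(\<exists>n::int. 2*pi*x = of_int (2*n) * pi) \<longleftrightarrow> x \<in> \<int>"
    by (auto elim!: Ints_cases)
  ultimately show ?thesis by simp
qed

lemma unit_exp_eq_iff: "unit_exp x = unit_exp y \<longleftrightarrow> x - y \<in> \<int>"
proof -
  have "unit_exp x = unit_exp (x - y) * unit_exp y"
    by (simp flip: unit_exp_add)
  then show ?thesis by (simp flip: unit_exp_eq_1_iff)
qed

lemma norm_unit_exp_minus_1: "norm (unit_exp x - 1) \<le> 2 * pi * \<bar>x\<bar>"
proof -
  have "norm (iexp (2*pi*x) - 1) \<le> \<bar>2*pi*x\<bar>"
    using iexp_approx1[of "2*pi*x" 0] by simp
  then show ?thesis
    by (simp add: unit_exp_def cis_conv_exp abs_mult)
qed

definition phase :: "nat \<Rightarrow> (nat \<Rightarrow> real) \<Rightarrow> (nat \<Rightarrow> int) \<Rightarrow> complex" where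
  "phase D f s = unit_exp (\<Sum>i<D. of_int (s i) * f i)"

text \<open>\<open>PiE\<close> fixes the values outside \<open>{..<D}\<close>, so the members can be
  counted as vectors of length \<open>D\<close>. Entries start at 1 to make the polynomial with
  these coefficients nonzero.\<close>

definition int_box :: "nat \<Rightarrow> nat \<Rightarrow> (nat \<Rightarrow> int) set" where
  "int_box D S = (\<Pi>\<^sub>E i\<in>{..<D}. {1..int S})"

definition diff_box :: "nat \<Rightarrow> nat \<Rightarrow> (nat \<Rightarrow> int) set" where
  "diff_box D S = (\<Pi>\<^sub>E i\<in>{..<D}. {- int S<..<int S})"

definition box_diff :: "nat \<Rightarrow> (nat \<Rightarrow> int) \<Rightarrow> (nat \<Rightarrow> int) \<Rightarrow> nat \<Rightarrow> int" where
  "box_diff D s s' = (\<lambda>i\<in>{..<D}. s' i - s i)"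

lemma phase_nonzero [simp]: "phase D f s \<noteq> 0"
  by (simp add: phase_def)

lemma phase_box_diff: "phase D f s' = phase D f (box_diff D s s') * phase D f s"
  unfolding phase_def unit_exp_add[symmetric] box_diff_def
  by (rule arg_cong[where f = unit_exp]) (simp add: algebra_simps flip: sum.distrib)

lemma finite_int_box [simp]: "finite (int_box D S)"
  and card_int_box: "card (int_box D S) = S ^ D"
  by (auto simp: int_box_def card_PiE intro!: finite_PiE)

lemma finite_diff_box [simp]: "finite (diff_box D S)"
  by (auto simp: diff_box_def intro!: finite_PiE)

lemma card_diff_box_le: "card (diff_box D S) \<le> (2 * S) ^ D"
proof -
  have "card {- int S<..<int S} \<le> 2 * S" by simp
  then have "card {- int S<..<int S} ^ D \<le> (2 * S) ^ D" by (intro power_mono) auto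
  then show ?thesis by (simp only: diff_box_def card_PiE finite_lessThan prod_constant card_lessThan)
qed

lemma box_diff_in_diff_box:
  "s \<in> int_box D S \<Longrightarrow> s' \<in> int_box D S \<Longrightarrow> box_diff D s s' \<in> diff_box D S"
  by (auto simp: int_box_def diff_box_def box_diff_def PiE_iff dest!: bspec)

lemma box_diff_inj:
  assumes "s \<in> int_box D S" "s' \<in> int_box D S" "s'' \<in> int_box D S"
    and "box_diff D s s' = box_diff D s s''"
  shows "s' = s''"
proof
  fix i
  show "s' i = s'' i"
  proof (cases "i < D")
    case True
    then show ?thesis using fun_cong[OF assms(4), of i] by (simp add: box_diff_def)
  next
    case False
    then show ?thesis using assms(2,3) by (auto simp: int_box_def PiE_def extensional_def)
  qed
qed

text \<open>If the difference \<open>f - g\<close> is irrational in coordinate \<open>i\<close>, then the other coordinates of a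
  vector on which the two characters agree determine its \<open>i\<close>-th coordinate.\<close>

lemma card_phase_coincidence_le:
  assumes i: "i < D" "f i - g i \<notin> \<rat>"
  shows "card {h \<in> diff_box D S. phase D f h = phase D g h} \<le> (2 * S) ^ (D - 1)"
proof -
  let ?B = "{h \<in> diff_box D S. phase D f h = phase D g h}"
  let ?J = "{..<D} - {i}"
  let ?P = "\<Pi>\<^sub>E j\<in>?J. {- int S<..<int S}"
  have "inj_on (\<lambda>h. restrict h ?J) ?B"
  proof (rule inj_onI)
    fix h h' assume h: "h \<in> ?B" and h': "h' \<in> ?B" and eq: "restrict h ?J = restrict h' ?J"
    have eqJ: "h j = h' j" if "j < D" "j \<noteq> i" for j
      using fun_cong[OF eq, of j] that by simp
    have int: "(\<Sum>j<D. of_int (k j) * (f j - g j)) \<in> \<int>" if "k \<in> ?B" for k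
      using that by (simp add: phase_def unit_exp_eq_iff right_diff_distrib sum_subtractf)
    have "(\<Sum>j<D. of_int (h j) * (f j - g j)) - (\<Sum>j<D. of_int (h' j) * (f j - g j)) \<in> \<int>"
      using int[OF h] int[OF h'] by (rule Ints_diff)
    also have "(\<Sum>j<D. of_int (h j) * (f j - g j)) - (\<Sum>j<D. of_int (h' j) * (f j - g j))
        = (\<Sum>j<D. of_int (h j - h' j) * (f j - g j))"
      by (simp add: sum_subtractf left_diff_distrib)
    also have "\<dots> = (\<Sum>j\<in>{i}. of_int (h j - h' j) * (f j - g j))"
      using i eqJ by (intro sum.mono_neutral_right) auto
    finally have *: "of_int (h i - h' i) * (f i - g i) \<in> \<int>" by simp
    have "h i = h' i"
    proof (rule ccontr)
      assume "h i \<noteq> h' i"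
      then have "f i - g i = (of_int (h i - h' i) * (f i - g i)) / of_int (h i - h' i)"
        by simp
      also have "\<dots> \<in> \<rat>"
        using * Ints_subset_Rats by (intro Rats_divide) auto
      finally show False using i by simp
    qed
    with eqJ have "h j = h' j" if "j < D" for j using that by (cases "j = i") auto
    then show "h = h'"
      using h h' by (intro PiE_ext[of h "{..<D}" _ h']) (auto simp: diff_box_def)
  qed
  then have "card ?B = card ((\<lambda>h. restrict h ?J) ` ?B)" by (simp add: card_image)
  also have "\<dots> \<le> card ?P"
    by (intro card_mono finite_PiE image_subsetI)
      (simp_all add: restrict_PiE_iff, auto simp: diff_box_def PiE_iff)
  also have "\<dots> = card {- int S<..<int S} ^ (D - 1)"
    using i by (simp add: card_PiE)
  also have "\<dots> \<le> (2 * S) ^ (D - 1)"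
    by (intro power_mono) auto
  finally show ?thesis .
qed

section \<open>Counting zeros of exponential sums by differencing\<close>

definition exp_sum_zeros :: "nat \<Rightarrow> nat \<Rightarrow> (nat \<Rightarrow> real) set \<Rightarrow> ((nat \<Rightarrow> real) \<Rightarrow> complex) \<Rightarrow> (nat \<Rightarrow> int) set"
  where "exp_sum_zeros D S X c = {s \<in> int_box D S. (\<Sum>f\<in>X. c f * phase D f s) = 0}"

text \<open>Mere distinctness would not do: characters whose frequencies differ by rational numbers
  agree on a sublattice, hence on a positive proportion of a large box.\<close>

definition rationally_separated :: "nat \<Rightarrow> (nat \<Rightarrow> real) set \<Rightarrow> bool" where
  "rationally_separated D X \<longleftrightarrow> (\<forall>f\<in>X. \<forall>g\<in>X. f \<noteq> g \<longrightarrow> (\<exists>i<D. f i - g i \<notin> \<rat>))"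

text \<open>Differencing: two zeros \<open>s\<close>, \<open>s + h\<close> of an exponential sum give the zero \<open>s\<close> of the sum with
  one frequency \<open>f\<^sub>0\<close> fewer, obtained by multiplying the value at \<open>s\<close> with the phase of \<open>f\<^sub>0\<close> at \<open>h\<close> and
  subtracting it from the value at \<open>s + h\<close>.\<close>

lemma card_exp_sum_zeros_squared_le:
  assumes X: "finite X" "f0 \<in> X" "rationally_separated D X" "\<And>f. f \<in> X \<Longrightarrow> c f \<noteq> 0"
    and N: "\<And>d. (\<And>f. f \<in> X - {f0} \<Longrightarrow> d f \<noteq> 0) \<Longrightarrow> card (exp_sum_zeros D S (X - {f0}) d) \<le> N"
  shows "(card (exp_sum_zeros D S X c))\<^sup>2 \<le>
           card X * (2 * S) ^ (D - 1) * card (exp_sum_zeros D S X c) + (2 * S) ^ D * N"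
proof -
  let ?Z = "exp_sum_zeros D S X c"
  let ?H = "diff_box D S"
  \<comment> \<open>\<open>bad\<close> holds the differences at which another character takes the
    same value as that of \<open>f0\<close>, so that differencing would destroy a further term.
    \<open>fiber h\<close> holds the zeros whose translate by \<open>h\<close> is again a
    zero.\<close>
  define bad where "bad = (\<Union>f\<in>X - {f0}. {h \<in> ?H. phase D f h = phase D f0 h})"
  define fiber where "fiber h = {s \<in> ?Z. \<exists>s'\<in>?Z. box_diff D s s' = h}" for h
  have Zbox: "?Z \<subseteq> int_box D S" by (auto simp: exp_sum_zeros_def)
  have finZ: "finite ?Z" using Zbox finite_subset finite_int_box by blast
  have finbad: "finite bad" and badH: "bad \<subseteq> ?H" using X by (auto simp: bad_def)
  have "card bad \<le> (\<Sum>f\<in>X - {f0}. card {h \<in> ?H. phase D f h = phase D f0 h})"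
    unfolding bad_def using X by (intro card_UN_le) auto
  also have "\<dots> \<le> (\<Sum>f\<in>X - {f0}. (2 * S) ^ (D - 1))"
  proof (rule sum_mono)
    fix f assume "f \<in> X - {f0}"
    then obtain i where "i < D" "f i - f0 i \<notin> \<rat>"
      using X unfolding rationally_separated_def by blast
    then show "card {h \<in> ?H. phase D f h = phase D f0 h} \<le> (2 * S) ^ (D - 1)"
      by (rule card_phase_coincidence_le)
  qed
  also have "\<dots> \<le> card X * (2 * S) ^ (D - 1)"
    using X by (simp add: card_Diff_singleton)
  finally have card_bad: "card bad \<le> card X * (2 * S) ^ (D - 1)" .
  have good: "card (fiber h) \<le> N" if h: "h \<in> ?H - bad" for h
  proof -
    define d where "d f = c f * (phase D f h - phase D f0 h)" for f
    have "d f \<noteq> 0" if "f \<in> X - {f0}" for f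
      using X h that by (auto simp: d_def bad_def)
    from N[OF this] have "card (exp_sum_zeros D S (X - {f0}) d) \<le> N" .
    moreover have "fiber h \<subseteq> exp_sum_zeros D S (X - {f0}) d"
    proof
      fix s assume "s \<in> fiber h"
      then obtain s' where s: "s \<in> ?Z" "s' \<in> ?Z" "box_diff D s s' = h"
        by (auto simp: fiber_def)
      have "(\<Sum>f\<in>X. c f * phase D f s') - phase D f0 h * (\<Sum>f\<in>X. c f * phase D f s) = 0"
        using s by (simp add: exp_sum_zeros_def)
      also have "(\<Sum>f\<in>X. c f * phase D f s') - phase D f0 h * (\<Sum>f\<in>X. c f * phase D f s)
          = (\<Sum>f\<in>X. d f * phase D f s)"
        unfolding phase_box_diff[of D _ s' s] s(3)
        by (simp add: d_def sum_distrib_left algebra_simps flip: sum_subtractf)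
      also have "\<dots> = (\<Sum>f\<in>X - {f0}. d f * phase D f s)"
        using X by (subst sum.remove[of _ f0]) (auto simp: d_def)
      finally show "s \<in> exp_sum_zeros D S (X - {f0}) d"
        using s by (simp add: exp_sum_zeros_def)
    qed
    moreover have "finite (exp_sum_zeros D S (X - {f0}) d)"
      by (simp add: exp_sum_zeros_def)
    ultimately show ?thesis by (meson card_mono order_trans)
  qed
  \<comment> \<open>A pair of zeros is determined by its difference and its first member, so pairs
    can be counted by difference: bad ones trivially, the others by their fibers of size at most
    \<open>N\<close>.\<close>
  have "inj_on (\<lambda>(s, s'). (box_diff D s s', s)) (?Z \<times> ?Z)"
    using Zbox box_diff_inj by (simp add: inj_on_def subset_iff) blast
  then have "(card ?Z)\<^sup>2 = card ((\<lambda>(s, s'). (box_diff D s s', s)) ` (?Z \<times> ?Z))"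
    by (simp add: card_image card_cartesian_product power2_eq_square)
  also have "\<dots> \<le> card ((bad \<times> ?Z) \<union> (SIGMA h:?H - bad. fiber h))"
  proof (rule card_mono)
    have "finite (fiber h)" for h using finZ by (simp add: fiber_def)
    then show "finite ((bad \<times> ?Z) \<union> (SIGMA h:?H - bad. fiber h))"
      using finbad finZ by auto
    show "(\<lambda>(s, s'). (box_diff D s s', s)) ` (?Z \<times> ?Z) \<subseteq> (bad \<times> ?Z) \<union> (SIGMA h:?H - bad. fiber h)"
      using box_diff_in_diff_box[OF subsetD[OF Zbox] subsetD[OF Zbox]] by (auto simp: fiber_def)
  qed
  also have "\<dots> \<le> card (bad \<times> ?Z) + card (SIGMA h:?H - bad. fiber h)"
    by (rule card_Un_le)
  also have "card (bad \<times> ?Z) = card bad * card ?Z" by (rule card_cartesian_product)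
  also have "\<dots> \<le> card X * (2 * S) ^ (D - 1) * card ?Z"
    using card_bad by (rule mult_right_mono) simp
  also have "card (SIGMA h:?H - bad. fiber h) = (\<Sum>h\<in>?H - bad. card (fiber h))"
    using finZ by (intro card_SigmaI) (auto simp: fiber_def)
  also have "\<dots> \<le> (\<Sum>h\<in>?H - bad. N)" using good by (intro sum_mono) auto
  also have "\<dots> \<le> card ?H * N" by (simp add: card_mono)
  also have "\<dots> \<le> (2 * S) ^ D * N" using card_diff_box_le by (rule mult_right_mono) simp
  finally show ?thesis by simp
qed

text \<open>Induction on the number of frequencies. A single character with nonzero coefficient has
  no zeros, and each differencing step halves the exponent because it bounds the square of the
  count. The constants depend only on \<open>n\<close> and \<open>D\<close>, so that one bound can
  serve all shifts of the frequencies.\<close>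

lemma card_exp_sum_zeros_le:
  assumes "D \<ge> 1"
  shows "\<exists>K e. K \<ge> 0 \<and> 0 < e \<and> e \<le> 1 \<and>
    (\<forall>S X c. S \<ge> 1 \<longrightarrow> card X = Suc n \<longrightarrow> rationally_separated D X \<longrightarrow> (\<forall>f\<in>X. c f \<noteq> 0) \<longrightarrow>
       real (card (exp_sum_zeros D S X c)) \<le> K * real S ^ D * real S powr (- e))"
proof (induction n)
  case 0
  have "exp_sum_zeros D S X c = {}" if "card X = Suc 0" "\<forall>f\<in>X. c f \<noteq> 0" for S X c
    using that by (auto simp: exp_sum_zeros_def card_1_singleton_iff)
  then show ?case by (intro exI[of _ 0] exI[of _ 1]) auto
next
  case (Suc n)
  then obtain K e where Ke: "K \<ge> 0" "0 < e" "e \<le> 1"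
    and IH: "\<And>S X c. S \<ge> 1 \<Longrightarrow> card X = Suc n \<Longrightarrow> rationally_separated D X \<Longrightarrow> (\<forall>f\<in>X. c f \<noteq> 0) \<Longrightarrow>
       real (card (exp_sum_zeros D S X c)) \<le> K * real S ^ D * real S powr (- e)"
    by blast
  \<comment> \<open>\<open>L\<close> collects the contributions of bad and of good differences, both
    of order \<open>S ^ (2 * D) * S powr (- e)\<close>; \<open>n + 2\<close> is the number of
    frequencies.\<close>
  define L where "L = (real n + 2) * 2 ^ (D - 1) + 2 ^ D * K"
  have L: "L \<ge> 0" using Ke by (simp add: L_def)
  have "real (card (exp_sum_zeros D S X c)) \<le> sqrt L * real S ^ D * real S powr (- (e / 2))"
    if S: "S \<ge> 1" and X: "card X = Suc (Suc n)" "rationally_separated D X" "\<forall>f\<in>X. c f \<noteq> 0" for S X c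
  proof -
    have finX: "finite X" using X(1) by (intro card_ge_0_finite) simp
    have "X \<noteq> {}" using X(1) by auto
    then obtain f0 where f0: "f0 \<in> X" by blast
    let ?Z = "exp_sum_zeros D S X c"
    define z where "z = real (card ?Z)"
    define N where "N = nat \<lfloor>K * real S ^ D * real S powr (- e)\<rfloor>"
    have N: "real N \<le> K * real S ^ D * real S powr (- e)"
      unfolding N_def using Ke by (intro of_nat_floor) auto
    have card_N: "card (exp_sum_zeros D S (X - {f0}) d) \<le> N"
      if "\<And>f. f \<in> X - {f0} \<Longrightarrow> d f \<noteq> 0" for d
    proof -
      have "card (X - {f0}) = Suc n" using X(1) f0 finX by simp
      moreover have "rationally_separated D (X - {f0})"
        using X(2) by (auto simp: rationally_separated_def)
      moreover have "\<forall>f\<in>X - {f0}. d f \<noteq> 0" using that by blast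
      ultimately have "real (card (exp_sum_zeros D S (X - {f0}) d))
          \<le> K * real S ^ D * real S powr (- e)"
        by (rule IH[OF S])
      then show ?thesis unfolding N_def by (rule le_nat_floor)
    qed
    have "(card ?Z)\<^sup>2 \<le> card X * (2 * S) ^ (D - 1) * card ?Z + (2 * S) ^ D * N"
    proof (rule card_exp_sum_zeros_squared_le[OF finX f0 X(2)])
      show "c f \<noteq> 0" if "f \<in> X" for f using X(3) that by blast
    qed (rule card_N)
    then have "real ((card ?Z)\<^sup>2) \<le> real (card X * (2 * S) ^ (D - 1) * card ?Z + (2 * S) ^ D * N)"
      by (rule of_nat_mono)
    then have "z\<^sup>2 \<le> real (card X) * (2 * real S) ^ (D - 1) * z + (2 * real S) ^ D * real N"
      by (simp add: z_def)
    also have "\<dots> \<le> real (card X) * (2 * real S) ^ (D - 1) * real S ^ D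
        + (2 * real S) ^ D * (K * real S ^ D * real S powr (- e))"
    proof (intro add_mono mult_left_mono N)
      have "card ?Z \<le> card (int_box D S)"
        by (intro card_mono) (auto simp: exp_sum_zeros_def)
      then show "z \<le> real S ^ D"
        unfolding z_def card_int_box using of_nat_mono by fastforce
    qed auto
    also have "\<dots> \<le> real (card X) * 2 ^ (D - 1) * (real S ^ D * (real S ^ D * real S powr (- e)))
        + 2 ^ D * K * (real S ^ D * (real S ^ D * real S powr (- e)))"
    proof (intro add_mono)
      \<comment> \<open>Bad differences save a full factor \<open>S\<close>, which is weakened to
        \<open>S powr e\<close>; this is why \<open>e \<le> 1\<close> is carried along.\<close>
      have "real S ^ (D - 1) = real S ^ D * real S powr (- 1)"
        using assms S by (cases D) (auto simp: powr_minus field_simps)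
      also have "\<dots> \<le> real S ^ D * real S powr (- e)"
        using Ke S by (intro mult_left_mono powr_mono) auto
      finally have "real (card X) * 2 ^ (D - 1) * (real S ^ D * real S ^ (D - 1))
         \<le> real (card X) * 2 ^ (D - 1) * (real S ^ D * (real S ^ D * real S powr (- e)))"
        by (intro mult_left_mono) auto
      then show "real (card X) * (2 * real S) ^ (D - 1) * real S ^ D
         \<le> real (card X) * 2 ^ (D - 1) * (real S ^ D * (real S ^ D * real S powr (- e)))"
        by (simp add: power_mult_distrib mult_ac)
    qed (simp add: power_mult_distrib mult_ac)
    also have "\<dots> = L * ((real S ^ D)\<^sup>2 * real S powr (- e))"
      using X(1) by (simp add: L_def power2_eq_square algebra_simps)
    also have "\<dots> = (sqrt L * real S ^ D * real S powr (- (e / 2)))\<^sup>2"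
    proof -
      have "(real S powr (- (e / 2)))\<^sup>2 = real S powr (- e)"
        by (simp add: power2_eq_square flip: powr_add)
      then show ?thesis using L by (simp add: power_mult_distrib)
    qed
    finally have "z\<^sup>2 \<le> (sqrt L * real S ^ D * real S powr (- (e / 2)))\<^sup>2" .
    then show ?thesis
      unfolding z_def by (rule power2_le_imp_le) (use L in auto)
  qed
  then show ?case using L Ke by (intro exI[of _ "sqrt L"] exI[of _ "e / 2"]) auto
qed

section \<open>Nearly integral phases and the choice of coefficients\<close>

lemma log_times_neg_powr_tendsto_0:
  fixes a b e :: real
  assumes "e > 0"
  shows "(\<lambda>S. (a * ln (real S) + b) * real S powr (- e)) \<longlonglongrightarrow> 0"
  using assms by real_asymp

text \<open>Each \<open>unit_exp (x l)\<close> lies within \<open>2 * pi * d\<close> of 1. For small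
  \<open>d\<close> this excludes zeros; for exponentially decaying \<open>d\<close> it controls
  infinite products.\<close>

lemma norm_weighted_unit_exp_sum_ge:
  fixes p x :: "'l \<Rightarrow> real"
  assumes p: "\<And>l. l \<in> L \<Longrightarrow> p l \<ge> 0"
    and x: "\<And>l. l \<in> L \<Longrightarrow> \<exists>n\<in>\<int>. \<bar>x l - n\<bar> \<le> d"
  shows "norm (\<Sum>l\<in>L. of_real (p l) * unit_exp (x l)) \<ge> (\<Sum>l\<in>L. p l) * (1 - 2 * pi * d)"
proof -
  have sum_nonneg: "(\<Sum>l\<in>L. p l) \<ge> 0" using p by (intro sum_nonneg) auto
  have near: "norm (1 - unit_exp (x l)) \<le> 2 * pi * d" if "l \<in> L" for l
  proof -
    from x[OF that] obtain n where n: "n \<in> \<int>" "\<bar>x l - n\<bar> \<le> d" by blast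
    have "unit_exp (x l) = unit_exp (x l - n)" using n by (simp add: unit_exp_eq_iff)
    then have "norm (1 - unit_exp (x l)) = norm (unit_exp (x l - n) - 1)"
      by (simp add: norm_minus_commute)
    also have "\<dots> \<le> 2 * pi * \<bar>x l - n\<bar>" by (rule norm_unit_exp_minus_1)
    also have "\<dots> \<le> 2 * pi * d" using n by simp
    finally show ?thesis .
  qed
  have "(\<Sum>l\<in>L. norm (of_real (p l) * (1 - unit_exp (x l)))) \<le> (\<Sum>l\<in>L. p l * (2 * pi * d))"
    using p near by (intro sum_mono) (simp add: norm_mult mult_left_mono)
  from order_trans[OF norm_sum this]
  have le: "norm (\<Sum>l\<in>L. of_real (p l) * (1 - unit_exp (x l))) \<le> (\<Sum>l\<in>L. p l) * (2 * pi * d)"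
    by (simp only: sum_distrib_right)
  have "(\<Sum>l\<in>L. p l) = norm (complex_of_real (\<Sum>l\<in>L. p l))"
    using sum_nonneg by (simp del: of_real_sum)
  also have "complex_of_real (\<Sum>l\<in>L. p l) = (\<Sum>l\<in>L. of_real (p l) * unit_exp (x l))
      + (\<Sum>l\<in>L. of_real (p l) * (1 - unit_exp (x l)))"
    by (simp add: right_diff_distrib sum_subtractf)
  also have "norm \<dots> \<le> norm (\<Sum>l\<in>L. of_real (p l) * unit_exp (x l)) + (\<Sum>l\<in>L. p l) * (2 * pi * d)"
    using le by (intro norm_triangle_le add_left_mono)
  finally show ?thesis by (simp add: right_diff_distrib)
qed

lemma weighted_unit_exp_sum_neq_0:
  fixes p x :: "'l \<Rightarrow> real"
  assumes L: "finite L" "L \<noteq> {}" "\<And>l. l \<in> L \<Longrightarrow> p l > 0"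
    and x: "\<And>l. l \<in> L \<Longrightarrow> \<exists>n\<in>\<int>. \<bar>x l - n\<bar> \<le> d" and d: "2 * pi * d < 1"
  shows "(\<Sum>l\<in>L. of_real (p l) * unit_exp (x l)) \<noteq> 0"
proof -
  have "(\<Sum>l\<in>L. p l) > 0" using L by (intro sum_pos) auto
  then have "0 < (\<Sum>l\<in>L. p l) * (1 - 2 * pi * d)" using d by simp
  also have "\<dots> \<le> norm (\<Sum>l\<in>L. of_real (p l) * unit_exp (x l))"
    using L(3) x by (intro norm_weighted_unit_exp_sum_ge) (auto intro: less_imp_le)
  finally show ?thesis by auto
qed

text \<open>For vectors \<open>s\<close> in the box of side \<open>S\<close>, the exponential sum at \<open>k\<close> can only vanish if
  \<open>\<bar>k\<bar> = O(log S)\<close>, and for each such \<open>k\<close> the proportion of zeros is \<open>O(S\<^bsup>-e\<^esup>)\<close>.\<close>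

lemma ex_nonvanishing_coefficients:
  fixes p :: "'l \<Rightarrow> real" and q :: "'l \<Rightarrow> int \<Rightarrow> real"
  assumes L: "finite L" "L \<noteq> {}" "\<And>l. l \<in> L \<Longrightarrow> p l > 0" and D: "D \<ge> 1"
    and \<rho>: "0 < \<rho>" "\<rho> < 1" and C: "C \<ge> 0"
    and near: "\<And>l j. l \<in> L \<Longrightarrow> \<exists>n\<in>\<int>. \<bar>q l j - n\<bar> \<le> C * \<rho> ^ nat \<bar>j\<bar>"
    and sep: "\<And>l l' k. l \<in> L \<Longrightarrow> l' \<in> L \<Longrightarrow> \<forall>i<D. q l (k + int i) - q l' (k + int i) \<in> \<rat> \<Longrightarrow> q l = q l'"
  shows "\<exists>s::nat \<Rightarrow> int. (\<forall>i<D. s i \<ge> 1) \<and>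
    (\<forall>k. (\<Sum>l\<in>L. of_real (p l) * unit_exp (\<Sum>i<D. of_int (s i) * q l (k + int i))) \<noteq> 0)"
proof -
  \<comment> \<open>\<open>fr k l\<close> is the window of the sequence \<open>q l\<close> starting
    at \<open>k\<close>. Indices with equal windows give the same character and are merged in
    \<open>c k f\<close>, which stays nonzero since the weights are positive.\<close>
  define fr where "fr k l = (\<lambda>i. q l (k + int i))" for k l
  define X where "X k = fr k ` L" for k
  define c where "c k f = complex_of_real (\<Sum>l\<in>{l\<in>L. fr k l = f}. p l)" for k f
  define Z where "Z S k = exp_sum_zeros D S (X k) (c k)" for S k
  have sum_eq: "(\<Sum>l\<in>L. of_real (p l) * unit_exp (\<Sum>i<D. of_int (s i) * q l (k + int i)))
      = (\<Sum>f\<in>X k. c k f * phase D f s)" for k s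
  proof -
    have "(\<Sum>l\<in>L. of_real (p l) * unit_exp (\<Sum>i<D. of_int (s i) * q l (k + int i)))
        = (\<Sum>l\<in>L. of_real (p l) * phase D (fr k l) s)"
      by (simp add: phase_def fr_def)
    also have "\<dots> = (\<Sum>f\<in>X k. \<Sum>l\<in>{l\<in>L. fr k l = f}. of_real (p l) * phase D (fr k l) s)"
      unfolding X_def by (rule sum.image_gen[OF L(1)])
    also have "\<dots> = (\<Sum>f\<in>X k. c k f * phase D f s)"
      by (auto simp: c_def sum_distrib_right intro!: sum.cong)
    finally show ?thesis .
  qed
  have c_nonzero: "c k f \<noteq> 0" if "f \<in> X k" for k f
  proof -
    have "(\<Sum>l\<in>{l\<in>L. fr k l = f}. p l) > 0"
      using that L by (intro sum_pos) (auto simp: X_def)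
    then show ?thesis by (simp add: c_def del: of_real_sum)
  qed
  have sep_X: "rationally_separated D (X k)" for k
    unfolding rationally_separated_def X_def
  proof (intro ballI impI)
    fix f g assume "f \<in> fr k ` L" "g \<in> fr k ` L" "f \<noteq> g"
    then obtain l l' where l: "l \<in> L" "l' \<in> L" "f = fr k l" "g = fr k l'" by blast
    have "q l \<noteq> q l'" using l \<open>f \<noteq> g\<close> by (auto simp: fr_def)
    then show "\<exists>i<D. f i - g i \<notin> \<rat>"
      using sep[OF l(1,2), of k] l by (auto simp: fr_def)
  qed
  obtain K e where K: "\<And>n. K n \<ge> 0" and e: "\<And>n. e n > 0"
    and Ke: "\<And>n S X c. S \<ge> 1 \<Longrightarrow> card X = Suc n \<Longrightarrow> rationally_separated D X \<Longrightarrow> \<forall>f\<in>X. c f \<noteq> 0 \<Longrightarrow>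
       real (card (exp_sum_zeros D S X c)) \<le> K n * real S ^ D * real S powr (- e n)"
    using card_exp_sum_zeros_le[OF D] by metis
  \<comment> \<open>The number of distinct frequencies at \<open>k\<close> lies between 1 and
    \<open>card L\<close>; adding the bounds for all these numbers makes \<open>\<delta> S\<close>
    independent of \<open>k\<close>.\<close>
  define \<delta> where "\<delta> S = (\<Sum>n<card L. K n * real S powr (- e n))" for S :: nat
  have card_Z: "real (card (Z S k)) \<le> real S ^ D * \<delta> S" if "S \<ge> 1" for S k
  proof -
    have "X k \<noteq> {}" "finite (X k)" using L by (auto simp: X_def)
    then have "card (X k) \<noteq> 0" by simp
    then obtain n where n: "card (X k) = Suc n" using not0_implies_Suc by blast
    have "card (X k) \<le> card L" using L by (simp add: X_def card_image_le)
    have "real (card (Z S k)) \<le> K n * real S ^ D * real S powr (- e n)"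
      unfolding Z_def by (rule Ke[OF that n sep_X]) (simp add: c_nonzero)
    also have "\<dots> = real S ^ D * (K n * real S powr (- e n))" by simp
    also have "K n * real S powr (- e n) \<le> \<delta> S"
      unfolding \<delta>_def using K n \<open>card (X k) \<le> card L\<close>
      by (intro member_le_sum[of n "{..<card L}" "\<lambda>n. K n * real S powr (- e n)"]) auto
    finally show ?thesis by (simp add: mult_left_mono)
  qed
  \<comment> \<open>A shift by less than \<open>D\<close> costs at most the factor
    \<open>1 / \<rho> ^ D\<close>; the rest comes from \<open>D\<close> terms with coefficients up
    to \<open>S\<close>. The summand 1 ensures \<open>B \<ge> 1\<close>, hence nonnegative
    logarithms below.\<close>
  define B where "B = 2 * pi * real D * C / \<rho> ^ D + 1"
  have B: "B \<ge> 1" using \<rho> C by (simp add: B_def)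
  have nonzero_far: "s \<notin> Z S k" if s: "s \<in> int_box D S" and far: "B * real S * \<rho> ^ nat \<bar>k\<bar> < 1" for s S k
  proof -
    have "\<exists>n\<in>\<int>. \<bar>(\<Sum>i<D. of_int (s i) * q l (k + int i)) - n\<bar> \<le> real D * (real S * (C * (\<rho> ^ nat \<bar>k\<bar> / \<rho> ^ D)))"
      if l: "l \<in> L" for l
    proof -
      have "\<forall>i. \<exists>n\<in>\<int>. \<bar>q l (k + int i) - n\<bar> \<le> C * \<rho> ^ nat \<bar>k + int i\<bar>"
        using near[OF l] by blast
      then obtain n where n: "\<And>i. n i \<in> \<int>" "\<And>i. \<bar>q l (k + int i) - n i\<bar> \<le> C * \<rho> ^ nat \<bar>k + int i\<bar>"
        by metis
      have "\<bar>of_int (s i) * q l (k + int i) - of_int (s i) * n i\<bar> \<le> real S * (C * (\<rho> ^ nat \<bar>k\<bar> / \<rho> ^ D))"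
        if i: "i < D" for i
      proof -
        have "1 \<le> s i \<and> s i \<le> int S" using s i by (auto simp: int_box_def PiE_iff)
        then have si: "0 \<le> s i" "s i \<le> int S" by auto
        have "\<rho> ^ D * \<rho> ^ nat \<bar>k + int i\<bar> \<le> \<rho> ^ nat \<bar>k\<bar>"
          unfolding power_add[symmetric] using \<rho> i by (intro power_decreasing) auto
        then have "\<rho> ^ nat \<bar>k + int i\<bar> \<le> \<rho> ^ nat \<bar>k\<bar> / \<rho> ^ D"
          using \<rho> by (simp add: field_simps)
        then have *: "C * \<rho> ^ nat \<bar>k + int i\<bar> \<le> C * (\<rho> ^ nat \<bar>k\<bar> / \<rho> ^ D)"
          using C by (rule mult_left_mono)
        have "\<bar>of_int (s i) * q l (k + int i) - of_int (s i) * n i\<bar> = of_int (s i) * \<bar>q l (k + int i) - n i\<bar>"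
          using si by (simp add: abs_mult flip: right_diff_distrib)
        also have "\<dots> \<le> real S * (C * (\<rho> ^ nat \<bar>k\<bar> / \<rho> ^ D))"
          using si n(2)[of i] * by (intro mult_mono) auto
        finally show ?thesis .
      qed
      then have "(\<Sum>i<D. \<bar>of_int (s i) * q l (k + int i) - of_int (s i) * n i\<bar>)
          \<le> (\<Sum>i<D. real S * (C * (\<rho> ^ nat \<bar>k\<bar> / \<rho> ^ D)))"
        by (intro sum_mono) auto
      from order_trans[OF sum_abs this]
      have "\<bar>(\<Sum>i<D. of_int (s i) * q l (k + int i)) - (\<Sum>i<D. of_int (s i) * n i)\<bar>
          \<le> real D * (real S * (C * (\<rho> ^ nat \<bar>k\<bar> / \<rho> ^ D)))"
        by (simp only: sum_subtractf sum_constant card_lessThan of_nat_id)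
      moreover have "(\<Sum>i<D. of_int (s i) * n i) \<in> \<int>"
        using n by (intro Ints_sum Ints_mult) auto
      ultimately show ?thesis by blast
    qed
    moreover have "2 * pi * (real D * (real S * (C * (\<rho> ^ nat \<bar>k\<bar> / \<rho> ^ D)))) < 1"
    proof -
      have "2 * pi * (real D * (real S * (C * (\<rho> ^ nat \<bar>k\<bar> / \<rho> ^ D)))) = (B - 1) * (real S * \<rho> ^ nat \<bar>k\<bar>)"
        by (simp add: B_def)
      also have "\<dots> \<le> B * (real S * \<rho> ^ nat \<bar>k\<bar>)"
        using \<rho> by (intro mult_right_mono) auto
      finally show ?thesis using far by (simp add: mult.assoc)
    qed
    ultimately show ?thesis
      using weighted_unit_exp_sum_neq_0[OF L(1,2), where p = p and x = "\<lambda>l. \<Sum>i<D. of_int (s i) * q l (k + int i)"]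
        L(3)
      unfolding Z_def exp_sum_zeros_def sum_eq by blast
  qed
  \<comment> \<open>A solution of \<open>B * S * \<rho> ^ M < 1\<close>; the added 1 makes the
    inequality strict.\<close>
  define M where "M S = nat \<lceil>ln (B * real S) / - ln \<rho>\<rceil> + 1" for S :: nat
  have far: "B * real S * \<rho> ^ nat \<bar>k\<bar> < 1" if "S \<ge> 1" "nat \<bar>k\<bar> \<ge> M S" for S k
  proof -
    have ln\<rho>: "ln \<rho> < 0" using \<rho> by simp
    have "ln (B * real S) / - ln \<rho> < real (M S)" unfolding M_def by linarith
    also have "\<dots> \<le> real (nat \<bar>k\<bar>)" using that by simp
    finally have "ln (B * real S) < real (nat \<bar>k\<bar>) * - ln \<rho>"
      using ln\<rho> by (subst (asm) pos_divide_less_eq) auto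
    then have "ln (B * real S * \<rho> ^ nat \<bar>k\<bar>) < 0"
      using that B \<rho> by (simp add: ln_mult ln_realpow)
    then show ?thesis using that B \<rho> by (subst (asm) ln_less_zero_iff) auto
  qed
  \<comment> \<open>The logarithmic factor bounds the number \<open>2 * M S + 1\<close> of shifts in
    the window: with \<open>x = ln (B * S) / - ln \<rho>\<close> one has
    \<open>M S \<le> x + 2\<close>, hence the bound \<open>2 * x + 5\<close>.\<close>
  have "(\<lambda>S. \<Sum>n<card L. K n * ((2 / - ln \<rho> * ln (real S) + (2 * ln B / - ln \<rho> + 5)) * real S powr (- e n))) \<longlonglongrightarrow> (\<Sum>n<card L. K n * 0)"
    using e by (intro tendsto_sum tendsto_mult_left log_times_neg_powr_tendsto_0)
  then have "\<forall>\<^sub>F S in sequentially. (\<Sum>n<card L. K n * ((2 / - ln \<rho> * ln (real S) + (2 * ln B / - ln \<rho> + 5)) * real S powr (- e n))) < 1"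
    by (intro order_tendstoD) auto
  then obtain S where S: "S \<ge> 1"
    and small: "(\<Sum>n<card L. K n * ((2 / - ln \<rho> * ln (real S) + (2 * ln B / - ln \<rho> + 5)) * real S powr (- e n))) < 1"
    using eventually_happens'[OF sequentially_bot eventually_conj[OF eventually_ge_at_top[of 1]]] by blast
  let ?ks = "{- int (M S)..int (M S)}"
  have \<delta>0: "\<delta> S \<ge> 0" unfolding \<delta>_def using K by (intro sum_nonneg) auto
  have "real (2 * M S + 1) \<le> 2 / - ln \<rho> * ln (real S) + (2 * ln B / - ln \<rho> + 5)"
  proof -
    have "ln (B * real S) / - ln \<rho> \<ge> 0"
      using S B \<rho> by (intro divide_nonneg_nonneg) (auto simp: ln_mult)
    then have "real (M S) \<le> ln (B * real S) / - ln \<rho> + 2" unfolding M_def by linarith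
    also have "ln (B * real S) = ln B + ln (real S)" using S B by (simp add: ln_mult)
    finally show ?thesis by (simp add: add_divide_distrib)
  qed
  then have "real (2 * M S + 1) * \<delta> S \<le> (2 / - ln \<rho> * ln (real S) + (2 * ln B / - ln \<rho> + 5)) * \<delta> S"
    using \<delta>0 by (rule mult_right_mono)
  also have "\<dots> < 1" using small unfolding \<delta>_def sum_distrib_left by (simp add: mult_ac)
  finally have lt1: "real (2 * M S + 1) * \<delta> S < 1" .
  \<comment> \<open>Union bound: fewer than \<open>S ^ D\<close> vectors annihilate some sum in the
    window, and outside the window no vector of the box does.\<close>
  have "real (card (\<Union>k\<in>?ks. Z S k)) \<le> (\<Sum>k\<in>?ks. real (card (Z S k)))"
    unfolding of_nat_sum[symmetric] by (intro of_nat_mono card_UN_le) simp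
  also have "\<dots> \<le> (\<Sum>k\<in>?ks. real S ^ D * \<delta> S)" by (intro sum_mono card_Z S)
  also have "\<dots> = real S ^ D * (real (2 * M S + 1) * \<delta> S)" by simp
  also have "\<dots> < real S ^ D * 1" using lt1 S by (intro mult_strict_left_mono) auto
  finally have "card (\<Union>k\<in>?ks. Z S k) < card (int_box D S)"
    by (simp add: card_int_box flip: of_nat_power)
  then have "\<not> int_box D S \<subseteq> (\<Union>k\<in>?ks. Z S k)"
    using card_mono[of "\<Union>k\<in>?ks. Z S k" "int_box D S"] by (auto simp: Z_def exp_sum_zeros_def)
  then obtain s where s: "s \<in> int_box D S" "\<And>k. k \<in> ?ks \<Longrightarrow> s \<notin> Z S k" by blast
  have "s \<notin> Z S k" for k
  proof (cases "k \<in> ?ks")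
    case False
    then have "nat \<bar>k\<bar> \<ge> M S" by auto
    then show ?thesis by (intro nonzero_far s far S)
  qed (rule s)
  then have nz: "(\<Sum>l\<in>L. of_real (p l) * unit_exp (\<Sum>i<D. of_int (s i) * q l (k + int i))) \<noteq> 0" for k
    using s(1) unfolding sum_eq by (simp add: Z_def exp_sum_zeros_def)
  have s_ge_1: "s i \<ge> 1" if "i < D" for i
    using s(1) that by (auto simp: int_box_def PiE_iff)
  show ?thesis by (rule exI[of _ s], intro conjI allI impI) (rule s_ge_1 nz, assumption?)+
qed

section \<open>Integer polynomials and their complex roots\<close>

lemma int_poly_eval_0 [simp]: "int_poly_eval 0 z = 0"
  by (simp add: int_poly_eval_def)

lemma int_poly_eval_pCons [simp]: "int_poly_eval (pCons a p) z = of_int a + z * int_poly_eval p z"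
  by (simp add: int_poly_eval_def map_poly_pCons)

lemma int_poly_eval_add [simp]: "int_poly_eval (p + q) z = int_poly_eval p z + int_poly_eval q z"
proof (induction p arbitrary: q)
  case (pCons a p)
  then show ?case by (cases q) (simp add: algebra_simps)
qed simp

lemma int_poly_eval_smult [simp]: "int_poly_eval (smult c p) z = of_int c * int_poly_eval p z"
  by (induction p) (simp_all add: algebra_simps)

lemma int_poly_eval_mult [simp]: "int_poly_eval (p * q) z = int_poly_eval p z * int_poly_eval q z"
  by (induction p) (simp_all add: algebra_simps)

lemma int_poly_eval_uminus [simp]: "int_poly_eval (- p) z = - int_poly_eval p z"
  using int_poly_eval_smult[of "- 1" p z] by simp

lemma int_poly_eval_diff [simp]: "int_poly_eval (p - q) z = int_poly_eval p z - int_poly_eval q z"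
  using int_poly_eval_add[of p "- q" z] by simp

lemma int_poly_eval_sum [simp]: "int_poly_eval (\<Sum>i\<in>A. f i) z = (\<Sum>i\<in>A. int_poly_eval (f i) z)"
  by (induction A rule: infinite_finite_induct) auto

lemma int_poly_eval_monom [simp]: "int_poly_eval (monom c n) z = of_int c * z ^ n"
  by (simp add: int_poly_eval_def map_poly_monom poly_monom)

lemma int_poly_eval_altdef: "int_poly_eval p z = (\<Sum>i\<le>degree p. of_int (coeff p i) * z ^ i)"
proof -
  have "int_poly_eval p z = int_poly_eval (\<Sum>i\<le>degree p. monom (coeff p i) i) z"
    by (simp add: poly_as_sum_of_monoms)
  then show ?thesis by simp
qed

lemma int_poly_eval_cnj: "int_poly_eval p (cnj z) = cnj (int_poly_eval p z)"
  by (simp add: int_poly_eval_altdef)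

section \<open>Roots with multiplicity and their power sums\<close>

text \<open>Counting roots with multiplicity makes the power sums integral for every monic
  \<open>G\<close>, separable or not.\<close>

definition complex_roots :: "int poly \<Rightarrow> complex multiset" where
  "complex_roots G = proots (map_poly of_int G)"

lemma map_poly_of_int_complex_eq_0_iff: "map_poly (of_int :: int \<Rightarrow> complex) G = 0 \<longleftrightarrow> G = 0"
  by (simp add: map_poly_eq_0_iff)

lemma in_complex_roots_iff: "G \<noteq> 0 \<Longrightarrow> z \<in># complex_roots G \<longleftrightarrow> int_poly_eval G z = 0"
  by (simp add: complex_roots_def int_poly_eval_def map_poly_of_int_complex_eq_0_iff)

lemma proots_prod_mset_linear: "proots (\<Prod>x\<in>#A. [:- x, 1:]) = (A :: 'a :: idom multiset)"
proof (induction A)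
  case (add x A)
  have "(\<Prod>x\<in>#A. [:- x, 1:]) \<noteq> (0 :: 'a poly)" by (auto simp: prod_mset_zero_iff)
  with add show ?case by (simp add: proots_mult del: mult_pCons_left)
qed simp

lemma monic_int_poly_factorization:
  assumes "lead_coeff G = 1"
  shows "map_poly of_int G = (\<Prod>r\<in>#complex_roots G. [:- r, 1:])"
proof -
  let ?G = "map_poly of_int G :: complex poly"
  have "?G \<noteq> 0" using assms by (auto simp: map_poly_of_int_complex_eq_0_iff)
  moreover have "lead_coeff ?G = 1"
    using assms by (simp add: lead_coeff_map_poly_nz)
  ultimately obtain A where "?G = (\<Prod>x\<in>#A. [:- x, 1:])"
    using alg_closed_imp_factorization[of ?G] by auto
  then show ?thesis by (simp add: complex_roots_def proots_prod_mset_linear)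
qed

lemma complex_roots_cnj: "image_mset cnj (complex_roots G) = complex_roots G"
proof (cases "G = 0")
  case False
  let ?G = "map_poly of_int G :: complex poly"
  define c where "c = lead_coeff ?G"
  have G0: "?G \<noteq> 0" using False by (simp add: map_poly_of_int_complex_eq_0_iff)
  then have c0: "c \<noteq> 0" by (simp add: c_def)
  obtain A where A: "?G = smult c (\<Prod>x\<in>#A. [:- x, 1:])"
    using alg_closed_imp_factorization[OF G0] unfolding c_def by blast
  have "?G = map_poly cnj ?G"
    by (rule poly_eqI) (simp add: coeff_map_poly)
  also have "\<dots> = smult (cnj c) (\<Prod>x\<in>#image_mset cnj A. [:- x, 1:])"
  proof (rule poly_eq_poly_eq_iff[THEN iffD1], rule ext)
    fix z
    have "cnj (\<Prod>x\<in>#A. cnj z - x) = (\<Prod>x\<in>#A. z - cnj x)" by (induction A) auto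
    then show "poly (map_poly cnj ?G) z = poly (smult (cnj c) (\<Prod>x\<in>#image_mset cnj A. [:- x, 1:])) z"
      unfolding poly_map_poly_cnj A by (simp add: poly_prod_mset multiset.map_comp o_def)
  qed
  finally have "proots ?G = image_mset cnj A"
    using c0 proots_prod_mset_linear[of "image_mset cnj A"] by simp
  moreover have "proots ?G = A" using A c0 by (simp add: proots_prod_mset_linear)
  ultimately show ?thesis by (simp add: complex_roots_def)
qed (simp add: complex_roots_def)

text \<open>The logarithmic derivative of the reversed polynomial is, up to sign, the generating function
  of the power sums of the roots.\<close>

lemma fps_deriv_prod_linear:
  fixes A :: "'a :: field multiset"
  shows "fps_deriv (\<Prod>r\<in>#A. 1 - fps_const r * fps_X)
    = - (\<Prod>r\<in>#A. 1 - fps_const r * fps_X) * Abs_fps (\<lambda>n. \<Sum>r\<in>#A. r ^ Suc n)"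
proof (induction A)
  case empty
  then show ?case by (simp add: fps_eq_iff)
next
  case (add r A)
  let ?E = "\<Prod>r\<in>#A. 1 - fps_const r * fps_X"
  let ?S = "Abs_fps (\<lambda>n. \<Sum>r\<in>#A. r ^ Suc n)"
  have geom: "(1 - fps_const r * fps_X) * Abs_fps (\<lambda>n. r ^ Suc n) = fps_const r"
  proof (rule fps_ext)
    fix n show "fps_nth ((1 - fps_const r * fps_X) * Abs_fps (\<lambda>n. r ^ Suc n)) n = fps_nth (fps_const r) n"
      by (cases n) (simp_all add: left_diff_distrib mult.assoc)
  qed
  have split: "Abs_fps (\<lambda>n. \<Sum>r\<in>#add_mset r A. r ^ Suc n) = Abs_fps (\<lambda>n. r ^ Suc n) + ?S"
    by (simp add: fps_eq_iff)
  have "fps_deriv (\<Prod>r\<in>#add_mset r A. 1 - fps_const r * fps_X)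
      = (1 - fps_const r * fps_X) * fps_deriv ?E - fps_const r * ?E"
    by (simp add: algebra_simps)
  also have "\<dots> = - (1 - fps_const r * fps_X) * ?E * ?S
      - ((1 - fps_const r * fps_X) * Abs_fps (\<lambda>n. r ^ Suc n)) * ?E"
    unfolding add.IH geom by (simp add: algebra_simps)
  also have "\<dots> = - (\<Prod>r\<in>#add_mset r A. 1 - fps_const r * fps_X)
      * Abs_fps (\<lambda>n. \<Sum>r\<in>#add_mset r A. r ^ Suc n)"
    unfolding split by (simp add: algebra_simps)
  finally show ?case .
qed

text \<open>Newton's identities: the reversed polynomial has integer coefficients and, as
  \<open>G\<close> is monic, constant coefficient 1, so each power sum is obtained from the earlier
  ones without division.\<close>

lemma power_sum_in_Ints:
  assumes "lead_coeff G = 1"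
  shows "(\<Sum>r\<in>#complex_roots G. r ^ n) \<in> \<int>"
proof -
  let ?G = "map_poly of_int G :: complex poly"
  define E where "E = (\<Prod>r\<in>#complex_roots G. 1 - fps_const r * fps_X)"
  define s where "s n = (\<Sum>r\<in>#complex_roots G. r ^ Suc n)" for n
  have "reflect_poly ?G = (\<Prod>r\<in>#complex_roots G. [:1, - r:])"
  proof -
    have "reflect_poly (\<Prod>r\<in>#A. [:- r, 1:]) = (\<Prod>r\<in>#A. [:1, - r:])" for A :: "complex multiset"
    proof (induction A)
      case (add r A)
      have "reflect_poly [:- r, 1:] = [:1, - r:]" by (simp add: reflect_poly_def)
      with add show ?case by (simp add: reflect_poly_mult del: mult_pCons_left)
    qed simp
    then show ?thesis using monic_int_poly_factorization[OF assms] by simp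
  qed
  moreover have "fps_of_poly (\<Prod>r\<in>#A. [:1, - r:]) = (\<Prod>r\<in>#A. 1 - fps_const r * fps_X)"
    for A :: "complex multiset"
  proof (induction A)
    case (add r A)
    have "fps_of_poly [:1, - r:] = 1 - fps_const r * fps_X"
      by (simp add: fps_of_poly_linear' flip: fps_const_neg)
    with add show ?case by (simp add: fps_of_poly_mult del: mult_pCons_left)
  qed simp
  ultimately have E: "E = fps_of_poly (reflect_poly ?G)" by (simp add: E_def)
  have E_int: "fps_nth E n \<in> \<int>" for n
    unfolding E by (simp add: coeff_reflect_poly coeff_map_poly)
  have E0: "fps_nth E 0 = 1"
    unfolding E using assms by (simp add: coeff_reflect_poly lead_coeff_map_poly_nz)
  have rec: "s n = - of_nat (Suc n) * fps_nth E (Suc n) - (\<Sum>i=1..n. fps_nth E i * s (n - i))" for n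
  proof -
    have "fps_nth (fps_deriv E) n = fps_nth (- E * Abs_fps s) n"
      unfolding E_def s_def by (subst fps_deriv_prod_linear) simp
    also have "\<dots> = - (\<Sum>i=0..n. fps_nth E i * s (n - i))"
      by (simp add: fps_mult_nth sum_negf)
    also have "(\<Sum>i=0..n. fps_nth E i * s (n - i)) = s n + (\<Sum>i=1..n. fps_nth E i * s (n - i))"
      by (subst sum.atLeast_Suc_atMost) (simp_all add: E0)
    finally have "of_nat (Suc n) * fps_nth E (Suc n) = - (s n + (\<Sum>i=1..n. fps_nth E i * s (n - i)))"
      by (simp only: fps_deriv_nth Suc_eq_plus1)
    then show ?thesis by (simp only: mult_minus_left) simp
  qed
  have "s n \<in> \<int>" for n
  proof (induction n rule: less_induct)
    case (less n)
    then have "(\<Sum>i=1..n. fps_nth E i * s (n - i)) \<in> \<int>"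
      by (intro Ints_sum Ints_mult E_int) auto
    then show ?case
      unfolding rec[of n] by (intro Ints_diff Ints_mult E_int Ints_minus) auto
  qed
  then show ?thesis by (cases n) (auto simp: s_def)
qed

lemma sum_mset_sum_swap:
  "(\<Sum>x\<in>#A. \<Sum>i\<in>I. f x i) = (\<Sum>i\<in>I. \<Sum>x\<in>#A. f x i)"
  by (induction A) (simp_all add: sum.distrib)

lemma sum_roots_int_poly_in_Ints:
  assumes "lead_coeff G = 1"
  shows "(\<Sum>r\<in>#complex_roots G. int_poly_eval p r) \<in> \<int>"
proof -
  have "(\<Sum>r\<in>#complex_roots G. int_poly_eval p r)
      = (\<Sum>i\<le>degree p. of_int (coeff p i) * (\<Sum>r\<in>#complex_roots G. r ^ i))"
    unfolding int_poly_eval_altdef sum_mset_distrib_left by (rule sum_mset_sum_swap)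
  also have "\<dots> \<in> \<int>"
    using power_sum_in_Ints[OF assms] by (intro Ints_sum Ints_mult) auto
  finally show ?thesis .
qed

text \<open>The polynomial below is monic by Gauss's lemma, because it divides a monic integer polynomial
  up to a constant.\<close>

lemma ex_monic_minimal_int_poly:
  assumes P: "lead_coeff P = 1" "int_poly_eval P \<gamma> = 0"
  obtains G where "lead_coeff G = 1" "int_poly_eval G \<gamma> = 0"
    "\<And>z. int_poly_eval G z = 0 \<Longrightarrow> int_poly_eval P z = 0"
    "\<And>h. int_poly_eval h \<gamma> = 0 \<Longrightarrow> degree h < degree G \<Longrightarrow> h = 0"
    "\<And>h z. int_poly_eval h \<gamma> = 0 \<Longrightarrow> int_poly_eval G z = 0 \<Longrightarrow> int_poly_eval h z = 0"
proof -
  define Q where "Q h \<longleftrightarrow> h \<noteq> 0 \<and> int_poly_eval h \<gamma> = 0" for h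
  have "Q P" using P by (auto simp: Q_def)
  define F where "F = (ARG_MIN degree h. Q h)"
  have QF: "Q F" and minF: "\<And>h. Q h \<Longrightarrow> degree F \<le> degree h"
    using arg_min_nat_lemma[of Q P degree] \<open>Q P\<close> unfolding F_def by auto
  have F0: "F \<noteq> 0" using QF by (simp add: Q_def)
  \<comment> \<open>Pseudo-division stays within integer polynomials at the price of the factor
    \<open>c\<close>. The remainder vanishes at \<open>\<gamma>\<close>, so by minimality of the
    degree of \<open>F\<close> it is 0.\<close>
  have dvdF: "\<exists>c q. c \<noteq> 0 \<and> smult c h = F * q" if "int_poly_eval h \<gamma> = 0" for h
  proof -
    obtain q r where qr: "pseudo_divmod h F = (q, r)" by fastforce
    note * = pseudo_divmod[OF F0 qr]
    let ?c = "coeff F (degree F) ^ (Suc (degree h) - degree F)"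
    have "int_poly_eval r \<gamma> = int_poly_eval (smult ?c h) \<gamma> - int_poly_eval (F * q) \<gamma>"
      unfolding *(1) by simp
    also have "\<dots> = 0" using that QF by (simp add: Q_def)
    finally have "r = 0" using *(2) minF[of r] by (fastforce simp: Q_def)
    then show ?thesis using * F0 by (intro exI[of _ ?c] exI[of _ q]) auto
  qed
  define G where "G = primitive_part F"
  have FG: "F = smult (content F) G" by (simp add: G_def)
  have cF: "content F \<noteq> 0" using F0 by simp
  have degG: "degree G = degree F" by (simp add: G_def)
  have contG: "content G = 1"
    using F0 by (simp add: G_def)
  have G\<gamma>: "int_poly_eval G \<gamma> = 0"
  proof -
    have "int_poly_eval (smult (content F) G) \<gamma> = 0"
      using QF unfolding FG[symmetric] Q_def by simp
    then show ?thesis using cF by simp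
  qed
  have dvdG: "\<exists>c q. c \<noteq> 0 \<and> smult c h = G * q" if h: "int_poly_eval h \<gamma> = 0" for h
  proof -
    obtain c q where "c \<noteq> 0" "smult c h = F * q" using dvdF[OF h] by blast
    moreover have "F * q = G * smult (content F) q"
      by (subst FG) simp
    ultimately show ?thesis by metis
  qed
  have roots: "int_poly_eval h z = 0" if h: "int_poly_eval h \<gamma> = 0" and "int_poly_eval G z = 0" for h z
  proof -
    obtain c q where cq: "c \<noteq> 0" "smult c h = G * q" using dvdG[OF h] by blast
    have "int_poly_eval (smult c h) z = 0" unfolding cq(2) using that by simp
    then show ?thesis using cq(1) by simp
  qed
  \<comment> \<open>\<open>P\<close> and \<open>G\<close> have content 1, so \<open>c\<close>
    divides the content of \<open>q\<close> and can be cancelled; then \<open>G\<close> divides the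
    monic \<open>P\<close> over the integers.\<close>
  have "\<bar>lead_coeff G\<bar> = 1"
  proof -
    obtain c q where cq: "c \<noteq> 0" "smult c P = G * q" using dvdG[OF P(2)] by blast
    have "content P = 1"
      using content_dvd_coeff[of P "degree P"] P by (metis is_unit_content_iff)
    then have "content q = normalize c"
      using arg_cong[OF cq(2), of content] contG by (simp add: content_mult)
    then have "c dvd content q" by simp
    then have "[:c:] dvd q" by (simp add: const_poly_dvd_iff_dvd_content)
    then obtain q' where "q = smult c q'" by (auto elim!: dvdE)
    then have "smult c P = smult c (G * q')" using cq by simp
    then have "P = G * q'" using cq(1) by (simp add: poly_eq_iff)
    then have "lead_coeff G * lead_coeff q' = 1" using P(1) by (simp add: lead_coeff_mult)
    then show ?thesis by (auto simp: zmult_eq_1_iff)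
  qed
  then have u: "lead_coeff G * lead_coeff G = 1" "lead_coeff G \<noteq> 0" by (auto simp: abs_if split: if_splits)
  have min: "h = 0" if "int_poly_eval h \<gamma> = 0" "degree h < degree G" for h
    using minF[of h] that degG by (fastforce simp: Q_def)
  let ?G = "smult (lead_coeff G) G"
  have root: "int_poly_eval ?G z = 0 \<longleftrightarrow> int_poly_eval G z = 0" for z
    using u by simp
  show ?thesis
  proof (rule that[of ?G])
    show "lead_coeff ?G = 1" using u by simp
    show "int_poly_eval ?G \<gamma> = 0" unfolding root by (rule G\<gamma>)
    show "int_poly_eval P z = 0" if "int_poly_eval ?G z = 0" for z
      using that unfolding root by (rule roots[OF P(2)])
    show "h = 0" if "int_poly_eval h \<gamma> = 0" "degree h < degree ?G" for h
      using that u by (intro min) auto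
    show "int_poly_eval h z = 0" if "int_poly_eval h \<gamma> = 0" "int_poly_eval ?G z = 0" for h z
      using that unfolding root by (rule roots)
  qed
qed

section \<open>Traces over the roots outside the unit disc\<close>

lemma sum_mset_single_support:
  fixes g :: "'a \<Rightarrow> 'b :: semiring_1"
  assumes "\<And>s. s \<in># A \<Longrightarrow> s \<noteq> r \<Longrightarrow> g s = 0"
  shows "(\<Sum>s\<in>#A. g s) = of_nat (count A r) * g r"
  using assms by (induction A) (auto simp: algebra_simps)

text \<open>Let \<open>R\<close> vanish at all members of \<open>A\<close> but \<open>r\<close>.
  Applied to the shift operator on sequences, it multiplies the term of \<open>s\<close> by
  \<open>poly R s\<close>, so only the term of \<open>r\<close> survives.\<close>

lemma exp_sum_isolate_term:
  fixes A :: "complex multiset"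
  assumes "r \<in># A"
  obtains R where "poly R r \<noteq> 0"
    "\<And>f n. (\<Sum>i\<le>degree R. coeff R i * (\<Sum>s\<in>#A. s ^ (n + i) * f s))
        = of_nat (count A r) * (r ^ n * poly R r * f r)"
proof
  define R where "R = (\<Prod>s\<in>set_mset A - {r}. [:- s, 1:])"
  show "poly R r \<noteq> 0" by (simp add: R_def poly_prod)
  fix f n
  have "(\<Sum>i\<le>degree R. coeff R i * (\<Sum>s\<in>#A. s ^ (n + i) * f s))
      = (\<Sum>s\<in>#A. \<Sum>i\<le>degree R. coeff R i * (s ^ (n + i) * f s))"
    unfolding sum_mset_sum_swap sum_mset_distrib_left ..
  also have "\<dots> = (\<Sum>s\<in>#A. s ^ n * poly R s * f s)"
    by (simp add: poly_altdef power_add sum_distrib_left sum_distrib_right mult_ac)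
  also have "\<dots> = of_nat (count A r) * (r ^ n * poly R r * f r)"
  proof (rule sum_mset_single_support)
    fix s assume "s \<in># A" "s \<noteq> r"
    then have "poly R s = 0" by (auto simp: R_def poly_prod)
    then show "s ^ n * poly R s * f s = 0" by simp
  qed
  finally show "(\<Sum>i\<le>degree R. coeff R i * (\<Sum>s\<in>#A. s ^ (n + i) * f s))
      = of_nat (count A r) * (r ^ n * poly R r * f r)" .
qed

lemma exp_sum_eventually_0:
  fixes A :: "complex multiset"
  assumes "\<And>n. n \<ge> N \<Longrightarrow> (\<Sum>s\<in>#A. s ^ n * f s) = 0" "r \<in># A" "r \<noteq> 0"
  shows "f r = 0"
proof -
  obtain R where R: "poly R r \<noteq> 0"
    "\<And>f n. (\<Sum>i\<le>degree R. coeff R i * (\<Sum>s\<in>#A. s ^ (n + i) * f s))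
        = of_nat (count A r) * (r ^ n * poly R r * f r)"
    using exp_sum_isolate_term[OF assms(2)] by blast
  have "of_nat (count A r) * (r ^ N * poly R r * f r) = 0"
    unfolding R(2)[symmetric] using assms(1) by simp
  moreover have "count A r \<noteq> 0" using assms(2) by simp
  ultimately show ?thesis using assms(3) R(1) by simp
qed

text \<open>The isolated term grows like \<open>norm r ^ n\<close> unless \<open>f r = 0\<close>,
  yet it is a fixed linear combination of bounded values.\<close>

lemma exp_sum_bounded_imp_0:
  fixes A :: "complex multiset"
  assumes bound: "\<And>n. norm (\<Sum>s\<in>#A. s ^ n * f s) \<le> B" and r: "r \<in># A" "norm r > 1"
  shows "f r = 0"
proof (rule ccontr)
  assume f: "f r \<noteq> 0"
  obtain R where R: "poly R r \<noteq> 0"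
    "\<And>f n. (\<Sum>i\<le>degree R. coeff R i * (\<Sum>s\<in>#A. s ^ (n + i) * f s))
        = of_nat (count A r) * (r ^ n * poly R r * f r)"
    using exp_sum_isolate_term[OF r(1)] by blast
  define c where "c = norm (of_nat (count A r) * (poly R r * f r))"
  have c: "c > 0" using f R(1) r by (simp add: c_def)
  define B' where "B' = (\<Sum>i\<le>degree R. norm (coeff R i) * B)"
  have le: "c * norm r ^ n \<le> B'" for n
  proof -
    have "c * norm r ^ n = norm (\<Sum>i\<le>degree R. coeff R i * (\<Sum>s\<in>#A. s ^ (n + i) * f s))"
      unfolding R(2) by (simp add: c_def norm_mult norm_power)
    also have "\<dots> \<le> B'"
      unfolding B'_def using bound by (intro sum_norm_le) (simp add: norm_mult mult_left_mono)
    finally show ?thesis .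
  qed
  obtain n where "B' / c < norm r ^ n" using real_arch_pow[OF r(2)] by blast
  then have "B' < c * norm r ^ n" using c by (simp add: field_simps)
  with le[of n] show False by simp
qed

lemma common_denominator:
  fixes x :: "nat \<Rightarrow> real"
  assumes "\<And>i. i < D \<Longrightarrow> x i \<in> \<rat>"
  shows "\<exists>d::nat. d > 0 \<and> (\<forall>i<D. of_nat d * x i \<in> \<int>)"
  using assms
proof (induction D)
  case 0
  then show ?case by auto
next
  case (Suc D)
  then obtain d where d: "d > 0" "\<And>i. i < D \<Longrightarrow> of_nat d * x i \<in> \<int>"
    by (metis less_SucI)
  have "x D \<in> \<rat>" using Suc.prems by simp
  then obtain a b :: int where ab: "b > 0" "x D = of_int a / of_int b"
    by (elim Rats_cases') auto
  have "of_nat (nat b * d) * x i \<in> \<int>" if "i < Suc D" for i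
  proof (cases "i = D")
    case True
    then have eq: "of_nat (nat b * d) * x i = of_nat d * of_int a" using ab by simp
    show ?thesis unfolding eq by simp
  next
    case False
    then have "of_nat d * x i \<in> \<int>" using that d by simp
    then have "of_nat (nat b) * (of_nat d * x i) \<in> \<int>" by (rule Ints_mult[rotated]) simp
    then show ?thesis by (simp add: mult.assoc)
  qed
  then show ?case using ab d by (intro exI[of _ "nat b * d"]) auto
qed

lemma norm_sum_mset_le: "norm (\<Sum>x\<in>#A. f x) \<le> (\<Sum>x\<in>#A. norm (f x))"
  for f :: "'a \<Rightarrow> 'b :: real_normed_vector"
  by (induction A) (auto intro: order_trans[OF norm_triangle_ineq])

lemma sum_mset_norm_nonneg: "(\<Sum>x\<in>#A. norm (f x)) \<ge> 0"
  by (induction A) auto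

lemma cnj_sum_mset: "cnj (\<Sum>x\<in>#A. f x) = (\<Sum>x\<in>#A. cnj (f x))"
  by (induction A) auto

text \<open>Nonreal roots come in conjugate pairs, so the sum is real and \<open>Re\<close> only
  changes the type. The exponent \<open>k\<close> may be negative.\<close>

definition outer_trace :: "int poly \<Rightarrow> int \<Rightarrow> int poly \<Rightarrow> real" where
  "outer_trace G k p = Re (\<Sum>r\<in>#filter_mset (\<lambda>r. norm r > 1) (complex_roots G). r powi k * int_poly_eval p r)"

text \<open>\<open>minimal\<close> and \<open>conjugate\<close> express that \<open>G\<close> is the
  minimal polynomial of \<open>\<gamma>\<close> without recourse to irreducibility. By
  \<open>modulus\<close> the roots split into an expanding and a contracting part.\<close>

locale hyperbolic_minimal_poly =
  fixes G :: "int poly" and \<gamma> :: complex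
  assumes monic: "lead_coeff G = 1"
    and root: "int_poly_eval G \<gamma> = 0" and inner: "norm \<gamma> < 1"
    and modulus: "int_poly_eval G r = 0 \<Longrightarrow> r \<noteq> 0 \<and> norm r \<noteq> 1"
    and minimal: "int_poly_eval h \<gamma> = 0 \<Longrightarrow> degree h < degree G \<Longrightarrow> h = 0"
    and conjugate: "int_poly_eval h \<gamma> = 0 \<Longrightarrow> int_poly_eval G z = 0 \<Longrightarrow> int_poly_eval h z = 0"
begin

abbreviation "Roots \<equiv> complex_roots G"
abbreviation "Outer \<equiv> filter_mset (\<lambda>r. norm r > 1) Roots"
abbreviation "Inner \<equiv> filter_mset (\<lambda>r. norm r < 1) Roots"
abbreviation "D \<equiv> degree G"
abbreviation "tr \<equiv> outer_trace G"

lemma G_nonzero: "G \<noteq> 0"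
  using monic by auto

lemma in_Roots: "r \<in># Roots \<longleftrightarrow> int_poly_eval G r = 0"
  by (rule in_complex_roots_iff[OF G_nonzero])

lemma \<gamma>_in_Inner: "\<gamma> \<in># Inner"
  using root inner by (simp add: in_Roots)

lemma D_pos: "D \<ge> 1"
proof (rule ccontr)
  assume "\<not> D \<ge> 1"
  then obtain c where "G = [:c:]" using degree_eq_zeroE[of G] by auto
  then have "G = 1" using monic by (simp add: one_pCons)
  then show False using root by (simp add: one_pCons)
qed

lemma Roots_split: "(\<Sum>r\<in>#Roots. f r) = (\<Sum>r\<in>#Outer. f r) + (\<Sum>r\<in>#Inner. f r)"
  for f :: "complex \<Rightarrow> 'b :: comm_monoid_add"
proof -
  have "filter_mset (\<lambda>r. \<not> norm r > 1) Roots = Inner"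
  proof (rule filter_mset_cong[OF refl])
    show "(\<not> norm r > 1) = (norm r < 1)" if "r \<in># Roots" for r
      using modulus[of r] that by (auto simp: in_Roots)
  qed
  then have "Roots = Outer + Inner" using multiset_partition[of Roots "\<lambda>r. norm r > 1"] by simp
  then have "image_mset f Roots = image_mset f Outer + image_mset f Inner"
    by (metis image_mset_union)
  then show ?thesis by simp
qed

lemma sum_filter_real:
  "(\<Sum>r\<in>#filter_mset (\<lambda>r. Q (norm r)) Roots. r ^ n * int_poly_eval p r) \<in> \<real>"
proof -
  let ?A = "filter_mset (\<lambda>r. Q (norm r)) Roots"
  have "image_mset cnj ?A = filter_mset (\<lambda>r. Q (norm r)) (image_mset cnj Roots)"
    by (simp add: filter_mset_image_mset)
  then have A: "image_mset cnj ?A = ?A" by (simp add: complex_roots_cnj)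
  have "cnj (\<Sum>r\<in>#?A. r ^ n * int_poly_eval p r) = (\<Sum>r\<in>#image_mset cnj ?A. r ^ n * int_poly_eval p r)"
    by (simp add: cnj_sum_mset int_poly_eval_cnj multiset.map_comp o_def)
  then show ?thesis unfolding A by (simp add: Reals_cnj_iff)
qed

lemma outer_trace_add: "tr k (p + q) = tr k p + tr k q"
  by (simp add: outer_trace_def ring_distribs sum_mset.distrib)

lemma outer_trace_diff: "tr k (p - q) = tr k p - tr k q"
  using outer_trace_add[of k "p - q" q] by simp

lemma outer_trace_sum: "tr k (\<Sum>i\<in>I. f i) = (\<Sum>i\<in>I. tr k (f i))"
  by (induction I rule: infinite_finite_induct) (auto simp: outer_trace_add, simp_all add: outer_trace_def)

lemma outer_trace_monom_mult: "tr k (monom c i * p) = of_int c * tr (k + int i) p"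
proof -
  have "r powi k * int_poly_eval (monom c i * p) r = of_int c * (r powi (k + int i) * int_poly_eval p r)"
    if "r \<in># Outer" for r
  proof -
    have "r \<noteq> 0" using that by auto
    then show ?thesis by (simp add: power_int_add)
  qed
  then have "(\<Sum>r\<in>#Outer. r powi k * int_poly_eval (monom c i * p) r)
     = of_int c * (\<Sum>r\<in>#Outer. r powi (k + int i) * int_poly_eval p r)"
    unfolding sum_mset_distrib_left by (intro arg_cong[where f = sum_mset] image_mset_cong)
  then show ?thesis by (simp add: outer_trace_def)
qed

lemma outer_trace_recurrence: "(\<Sum>i\<le>D. of_int (coeff G i) * tr (k + int i) p) = 0"
proof -
  have "(\<Sum>i\<le>D. of_int (coeff G i) * tr (k + int i) p) = tr k (\<Sum>i\<le>D. monom (coeff G i) i * p)"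
    by (simp add: outer_trace_sum outer_trace_monom_mult)
  also have "(\<Sum>i\<le>D. monom (coeff G i) i * p) = G * p"
    by (simp add: poly_as_sum_of_monoms flip: sum_distrib_right)
  also have "tr k (G * p) = 0"
  proof -
    have "r powi k * int_poly_eval (G * p) r = 0" if "r \<in># Outer" for r
      using that by (auto simp: in_Roots)
    then have "(\<Sum>r\<in>#Outer. r powi k * int_poly_eval (G * p) r) = (\<Sum>r\<in>#Outer. 0)"
      by (intro arg_cong[where f = sum_mset] image_mset_cong)
    then show ?thesis by (simp add: outer_trace_def)
  qed
  finally show ?thesis .
qed

lemma full_trace_in_Ints: "Re (\<Sum>r\<in>#Roots. r ^ n * int_poly_eval p r) \<in> \<int>"
proof -
  have "(\<Sum>r\<in>#Roots. int_poly_eval (monom 1 n * p) r) \<in> \<int>"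
    by (rule sum_roots_int_poly_in_Ints[OF monic])
  then show ?thesis by (auto elim!: Ints_cases)
qed

lemma outer_trace_nat: "tr (int n) p = Re (\<Sum>r\<in>#Roots. r ^ n * int_poly_eval p r)
    - Re (\<Sum>r\<in>#Inner. r ^ n * int_poly_eval p r)"
  unfolding outer_trace_def Roots_split by simp

lemma ex_contraction_rate:
  "\<exists>\<rho>. 0 < \<rho> \<and> \<rho> < 1 \<and> (\<forall>r\<in>#Inner. norm r \<le> \<rho>) \<and> (\<forall>r\<in>#Outer. inverse (norm r) \<le> \<rho>)"
proof (intro exI conjI ballI)
  let ?M = "insert (1/2) (norm ` set_mset Inner \<union> (\<lambda>r. inverse (norm r)) ` set_mset Outer)"
  have fin: "finite ?M" by simp
  show "0 < Max ?M" using Max_ge[OF fin, of "1/2"] by simp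
  show "Max ?M < 1" using fin by (subst Max_less_iff) (auto simp: inverse_less_1_iff)
  show "norm r \<le> Max ?M" if "r \<in># Inner" for r using that by (intro Max_ge fin) auto
  show "inverse (norm r) \<le> Max ?M" if "r \<in># Outer" for r using that by (intro Max_ge fin) auto
qed

lemma norm_inner_sum_le:
  assumes "\<And>r. r \<in># Inner \<Longrightarrow> norm r \<le> \<rho>"
  shows "norm (\<Sum>r\<in>#Inner. r ^ n * int_poly_eval p r) \<le> (\<Sum>r\<in>#Roots. norm (int_poly_eval p r)) * \<rho> ^ n"
proof -
  have "norm (\<Sum>r\<in>#Inner. r ^ n * int_poly_eval p r) \<le> (\<Sum>r\<in>#Inner. norm (r ^ n * int_poly_eval p r))"
    by (rule norm_sum_mset_le)
  also have "\<dots> \<le> (\<Sum>r\<in>#Inner. norm (int_poly_eval p r) * \<rho> ^ n)"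
  proof (rule sum_mset_mono)
    fix r assume "r \<in># Inner"
    then have "norm r ^ n \<le> \<rho> ^ n" using assms by (intro power_mono) auto
    then show "norm (r ^ n * int_poly_eval p r) \<le> norm (int_poly_eval p r) * \<rho> ^ n"
      by (simp add: norm_mult norm_power mult.commute[of "norm r ^ n"] mult_left_mono)
  qed
  also have "\<dots> = (\<Sum>r\<in>#Inner. norm (int_poly_eval p r)) * \<rho> ^ n"
    by (rule sum_mset_distrib_right[symmetric])
  also have "\<dots> \<le> (\<Sum>r\<in>#Roots. norm (int_poly_eval p r)) * \<rho> ^ n"
  proof (rule mult_right_mono)
    have "norm \<gamma> \<le> \<rho>" using assms \<gamma>_in_Inner by blast
    from order_trans[OF norm_ge_zero this] show "\<rho> ^ n \<ge> 0" by simp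
    show "(\<Sum>r\<in>#Inner. norm (int_poly_eval p r)) \<le> (\<Sum>r\<in>#Roots. norm (int_poly_eval p r))"
      unfolding Roots_split by (simp add: sum_mset_norm_nonneg)
  qed
  finally show ?thesis .
qed

text \<open>For \<open>k \<ge> 0\<close> the trace over all roots is an integer and the error, the
  sum over inner roots, decays. For \<open>k < 0\<close> the outer sum itself decays and the integer
  is 0.\<close>

lemma outer_trace_near_int:
  assumes \<rho>: "0 < \<rho>" "\<rho> < 1" "\<And>r. r \<in># Inner \<Longrightarrow> norm r \<le> \<rho>" "\<And>r. r \<in># Outer \<Longrightarrow> inverse (norm r) \<le> \<rho>"
  shows "\<exists>n\<in>\<int>. \<bar>tr k p - n\<bar> \<le> (\<Sum>r\<in>#Roots. norm (int_poly_eval p r)) * \<rho> ^ nat \<bar>k\<bar>"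
proof (cases "k \<ge> 0")
  case True
  then obtain n where k: "k = int n" using nonneg_int_cases by blast
  have "\<bar>Re (\<Sum>r\<in>#Inner. r ^ n * int_poly_eval p r)\<bar> \<le> (\<Sum>r\<in>#Roots. norm (int_poly_eval p r)) * \<rho> ^ n"
    by (rule order_trans[OF abs_Re_le_cmod norm_inner_sum_le[OF \<rho>(3)]])
  then show ?thesis
    using full_trace_in_Ints[of n p] unfolding k
    by (intro bexI[of _ "Re (\<Sum>r\<in>#Roots. r ^ n * int_poly_eval p r)"]) (simp_all add: outer_trace_nat)
next
  case False
  define n where "n = nat \<bar>k\<bar>"
  have k: "k = - int n" using False by (simp add: n_def)
  have "\<bar>tr k p\<bar> \<le> norm (\<Sum>r\<in>#Outer. r powi k * int_poly_eval p r)"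
    unfolding outer_trace_def by (rule abs_Re_le_cmod)
  also have "\<dots> \<le> (\<Sum>r\<in>#Outer. norm (r powi k * int_poly_eval p r))"
    by (rule norm_sum_mset_le)
  also have "\<dots> \<le> (\<Sum>r\<in>#Outer. norm (int_poly_eval p r) * \<rho> ^ n)"
  proof (rule sum_mset_mono)
    fix r assume "r \<in># Outer"
    then have "inverse (norm r) ^ n \<le> \<rho> ^ n" using \<rho>(4) by (intro power_mono) auto
    then show "norm (r powi k * int_poly_eval p r) \<le> norm (int_poly_eval p r) * \<rho> ^ n"
      unfolding k by (simp add: norm_mult norm_power norm_inverse power_int_minus power_inverse
          mult.commute[of "inverse (norm r ^ n)"] mult_left_mono)
  qed
  also have "\<dots> = (\<Sum>r\<in>#Outer. norm (int_poly_eval p r)) * \<rho> ^ n"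
    by (rule sum_mset_distrib_right[symmetric])
  also have "\<dots> \<le> (\<Sum>r\<in>#Roots. norm (int_poly_eval p r)) * \<rho> ^ n"
    using \<rho> unfolding Roots_split by (intro mult_right_mono) (auto simp: sum_mset_norm_nonneg)
  finally show ?thesis unfolding n_def by (intro bexI[of _ 0]) auto
qed

text \<open>The inner sums tend to 0, so lying in a discrete group they vanish from some index on.
  Then every term vanishes separately, in particular that of \<open>\<gamma>\<close>.\<close>

lemma root_if_inner_sum_discrete:
  assumes d: "d > 0" and int: "\<And>n. n \<ge> N \<Longrightarrow> of_nat d * Re (\<Sum>r\<in>#Inner. r ^ n * int_poly_eval p r) \<in> \<int>"
  shows "int_poly_eval p \<gamma> = 0"
proof -
  obtain \<rho> where \<rho>: "0 < \<rho>" "\<rho> < 1" "\<And>r. r \<in># Inner \<Longrightarrow> norm r \<le> \<rho>"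
    "\<And>r. r \<in># Outer \<Longrightarrow> inverse (norm r) \<le> \<rho>"
    using ex_contraction_rate by auto
  define C where "C = (\<Sum>r\<in>#Roots. norm (int_poly_eval p r))"
  have "(\<lambda>n. real d * (C * \<rho> ^ n)) \<longlonglongrightarrow> real d * (C * 0)"
    using \<rho> by (intro tendsto_mult_left LIMSEQ_power_zero) auto
  then have "\<forall>\<^sub>F n in sequentially. real d * (C * \<rho> ^ n) < 1"
    by (intro order_tendstoD) auto
  then obtain N' where N': "\<And>n. n \<ge> N' \<Longrightarrow> real d * (C * \<rho> ^ n) < 1"
    by (auto simp: eventually_sequentially)
  have zero: "(\<Sum>r\<in>#Inner. r ^ n * int_poly_eval p r) = 0" if n: "n \<ge> max N N'" for n
  proof -
    let ?s = "\<Sum>r\<in>#Inner. r ^ n * int_poly_eval p r"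
    have "\<bar>Re ?s\<bar> \<le> C * \<rho> ^ n"
      unfolding C_def by (rule order_trans[OF abs_Re_le_cmod norm_inner_sum_le[OF \<rho>(3)]])
    then have "\<bar>of_nat d * Re ?s\<bar> \<le> real d * (C * \<rho> ^ n)"
      by (simp add: abs_mult mult_left_mono)
    also have "\<dots> < 1" using N' n by simp
    finally have "of_nat d * Re ?s = 0"
      using int[of n] n by (intro Ints_nonzero_abs_less1) auto
    then have "Re ?s = 0" using d by simp
    moreover have "?s \<in> \<real>" by (rule sum_filter_real)
    ultimately show ?thesis by (simp add: complex_is_Real_iff complex_eq_iff)
  qed
  show ?thesis
  proof (rule exp_sum_eventually_0[where f = "int_poly_eval p" and N = "max N N'"])
    show "\<gamma> \<noteq> 0" using modulus[OF root] by simp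
  qed (rule zero \<gamma>_in_Inner; assumption)+
qed

text \<open>A common denominator of \<open>D\<close> consecutive values persists for all later ones,
  the recurrence being monic with integer coefficients. As full traces are integers, it is
  eventually a denominator of the inner sums too.\<close>

lemma root_if_outer_trace_rational:
  assumes rat: "\<And>i. i < D \<Longrightarrow> tr (k + int i) p \<in> \<rat>"
  shows "int_poly_eval p \<gamma> = 0"
proof -
  obtain d :: nat where d: "d > 0" "\<And>i. i < D \<Longrightarrow> of_nat d * tr (k + int i) p \<in> \<int>"
    using common_denominator[of D "\<lambda>i. tr (k + int i) p"] rat by blast
  have int: "of_nat d * tr (k + int i) p \<in> \<int>" for i
  proof (induction i rule: less_induct)
    case (less i)
    show ?case
    proof (cases "i < D")
      case False
      \<comment> \<open>The recurrence over \<open>D + 1\<close> consecutive indices starting at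
        \<open>j\<close> ends at \<open>k + int i\<close>.\<close>
      define j where "j = k + int (i - D)"
      have "(\<Sum>i<D. of_int (coeff G i) * tr (j + int i) p) + tr (j + int D) p = 0"
        using outer_trace_recurrence[of j p] monic by (simp add: lessThan_Suc_atMost[symmetric])
      moreover have "j + int D = k + int i" using False by (simp add: j_def)
      ultimately have "tr (k + int i) p = - (\<Sum>i<D. of_int (coeff G i) * tr (j + int i) p)"
        by simp
      then have "of_nat d * tr (k + int i) p = - (\<Sum>i<D. of_int (coeff G i) * (of_nat d * tr (j + int i) p))"
        by (simp only: mult_minus_right sum_distrib_left mult.left_commute)
      also have "\<dots> \<in> \<int>"
      proof (intro Ints_minus Ints_sum)
        fix i' assume "i' \<in> {..<D}"
        then have j_eq: "k + int (i - D + i') = j + int i'" and lt: "i - D + i' < i"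
          using False by (auto simp: j_def)
        from less[OF lt] have "of_nat d * tr (j + int i') p \<in> \<int>" unfolding j_eq .
        then show "of_int (coeff G i') * (of_nat d * tr (j + int i') p) \<in> \<int>"
          by (rule Ints_mult[OF Ints_of_int])
      qed
      finally show ?thesis .
    qed (use d in auto)
  qed
  show ?thesis
  proof (rule root_if_inner_sum_discrete[OF d(1), of "nat \<bar>k\<bar>"])
    fix n assume n: "n \<ge> nat \<bar>k\<bar>"
    then have "k \<le> int n" by linarith
    then have n_eq: "k + int (nat (int n - k)) = int n" by simp
    have "of_nat d * tr (int n) p \<in> \<int>" using int[of "nat (int n - k)"] unfolding n_eq .
    from Ints_diff[OF Ints_mult[OF Ints_of_nat[of d] full_trace_in_Ints[of n p]] this]
    show "of_nat d * Re (\<Sum>r\<in>#Inner. r ^ n * int_poly_eval p r) \<in> \<int>"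
      unfolding outer_trace_nat right_diff_distrib diff_diff_eq2 add_diff_cancel_left' .
  qed
qed

text \<open>Boundedness forces \<open>p\<close> to vanish at all outer roots, so the inner sums are
  integers. The argument covers the case without outer roots, which is then ruled out by taking
  \<open>p = 1\<close>.\<close>

lemma root_if_outer_trace_bounded:
  assumes "\<And>n. \<bar>tr (int n) p\<bar> \<le> B"
  shows "int_poly_eval p \<gamma> = 0"
proof -
  have outer0: "int_poly_eval p r = 0" if r: "r \<in># Outer" for r
  proof (rule exp_sum_bounded_imp_0[OF _ r])
    fix n
    have "(\<Sum>r\<in>#Outer. r ^ n * int_poly_eval p r) \<in> \<real>" by (rule sum_filter_real)
    then have "norm (\<Sum>r\<in>#Outer. r ^ n * int_poly_eval p r) = \<bar>tr (int n) p\<bar>"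
      by (simp add: outer_trace_def in_Reals_norm complex_is_Real_iff cmod_eq_Re)
    then show "norm (\<Sum>r\<in>#Outer. r ^ n * int_poly_eval p r) \<le> B" using assms by simp
  qed (use r in auto)
  have "tr (int n) p = 0" for n
  proof -
    have "(\<Sum>r\<in>#Outer. r powi (int n) * int_poly_eval p r) = (\<Sum>r\<in>#Outer. 0)"
      by (intro arg_cong[where f = sum_mset] image_mset_cong) (simp only: outer0 mult_zero_right)
    then show ?thesis by (simp add: outer_trace_def)
  qed
  then have int: "Re (\<Sum>r\<in>#Inner. r ^ n * int_poly_eval p r) \<in> \<int>" for n
    using full_trace_in_Ints[of n p] outer_trace_nat[of n p] by simp
  show ?thesis
    by (rule root_if_inner_sum_discrete[of 1 0]) (simp_all only: of_nat_1 mult_1 int zero_less_one)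
qed

lemma Outer_nonempty: "Outer \<noteq> {#}"
proof
  assume empty: "Outer = {#}"
  have "\<bar>tr (int n) 1\<bar> \<le> 0" for n unfolding outer_trace_def empty by simp
  from root_if_outer_trace_bounded[OF this] show False by (simp add: one_pCons)
qed

text \<open>Multiplication by \<open>Q\<close> replaces a sequence of traces by combinations of
  \<open>D\<close> consecutive ones, with the coefficients of \<open>Q\<close> as weights;
  \<open>ex_nonvanishing_coefficients\<close> supplies these.\<close>

lemma ex_multiplier_nonvanishing:
  fixes P :: "'l \<Rightarrow> int poly" and p :: "'l \<Rightarrow> real"
  assumes L: "finite L" "L \<noteq> {}" "\<And>l. l \<in> L \<Longrightarrow> p l > 0"
  shows "\<exists>Q. int_poly_eval Q \<gamma> \<noteq> 0 \<and>
    (\<forall>k. (\<Sum>l\<in>L. of_real (p l) * unit_exp (tr k (Q * P l))) \<noteq> 0)"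
proof -
  obtain \<rho> where \<rho>: "0 < \<rho>" "\<rho> < 1" "\<And>r. r \<in># Inner \<Longrightarrow> norm r \<le> \<rho>"
    "\<And>r. r \<in># Outer \<Longrightarrow> inverse (norm r) \<le> \<rho>"
    using ex_contraction_rate by auto
  define c where "c l = (\<Sum>r\<in>#Roots. norm (int_poly_eval (P l) r))" for l
  have c: "c l \<ge> 0" for l unfolding c_def by (simp add: sum_mset_norm_nonneg)
  define C where "C = (\<Sum>l\<in>L. c l)"
  have C: "C \<ge> 0" unfolding C_def using c by (simp add: sum_nonneg)
  have near: "\<exists>n\<in>\<int>. \<bar>tr j (P l) - n\<bar> \<le> C * \<rho> ^ nat \<bar>j\<bar>" if "l \<in> L" for l j
  proof -
    have "c l \<le> C" unfolding C_def using that L c by (intro member_le_sum) auto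
    then have "c l * \<rho> ^ nat \<bar>j\<bar> \<le> C * \<rho> ^ nat \<bar>j\<bar>" using \<rho> by (intro mult_right_mono) auto
    then show ?thesis using outer_trace_near_int[OF \<rho>, of j "P l"] unfolding c_def[symmetric]
      by (meson order_trans)
  qed
  \<comment> \<open>Rational differences on a window force \<open>P l\<close> and
    \<open>P l'\<close> to agree at \<open>\<gamma>\<close>, hence at its conjugates outside the
    disc.\<close>
  have sep: "(\<lambda>j. tr j (P l)) = (\<lambda>j. tr j (P l'))"
    if "\<forall>i<D. tr (k + int i) (P l) - tr (k + int i) (P l') \<in> \<rat>" for l l' k
  proof -
    have "int_poly_eval (P l - P l') \<gamma> = 0"
      using that by (intro root_if_outer_trace_rational[of k]) (simp add: outer_trace_diff)
    then have eq: "int_poly_eval (P l) r = int_poly_eval (P l') r" if "r \<in># Outer" for r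
      using conjugate[of "P l - P l'" r] that by (simp add: in_Roots)
    have "image_mset (\<lambda>r. r powi j * int_poly_eval (P l) r) Outer
        = image_mset (\<lambda>r. r powi j * int_poly_eval (P l') r) Outer" for j
      by (rule image_mset_cong) (simp only: eq)
    then show ?thesis by (simp only: outer_trace_def)
  qed
  have "\<exists>s::nat \<Rightarrow> int. (\<forall>i<D. s i \<ge> 1) \<and>
    (\<forall>k. (\<Sum>l\<in>L. of_real (p l) * unit_exp (\<Sum>i<D. of_int (s i) * tr (k + int i) (P l))) \<noteq> 0)"
    by (rule ex_nonvanishing_coefficients[where q = "\<lambda>l j. tr j (P l)"])
      (rule L D_pos \<rho>(1,2) C near sep; assumption)+
  then obtain s :: "nat \<Rightarrow> int" where s: "\<And>i. i < D \<Longrightarrow> s i \<ge> 1"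
    "\<And>k. (\<Sum>l\<in>L. of_real (p l) * unit_exp (\<Sum>i<D. of_int (s i) * tr (k + int i) (P l))) \<noteq> 0"
    by blast
  define Q where "Q = (\<Sum>i<D. monom (s i) i)"
  have coeff_Q: "coeff Q j = (if j < D then s j else 0)" for j
    by (simp add: Q_def coeff_sum)
  \<comment> \<open>\<open>Q\<close> is nonzero because its coefficients below \<open>D\<close> are
    at least 1, and its degree is too small for it to vanish at \<open>\<gamma>\<close>.\<close>
  have "degree Q < D"
    using D_pos by (intro degree_lessI) (auto simp: coeff_Q)
  moreover have "Q \<noteq> 0" using coeff_Q[of 0] s(1)[of 0] D_pos by auto
  ultimately have "int_poly_eval Q \<gamma> \<noteq> 0" using minimal by blast
  moreover have "tr k (Q * P l) = (\<Sum>i<D. of_int (s i) * tr (k + int i) (P l))" for k l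
    by (simp add: Q_def sum_distrib_right outer_trace_sum outer_trace_monom_mult)
  ultimately show ?thesis using s(2) by (intro exI[of _ Q]) simp
qed

end

section \<open>Affine irreducibility and the Fourier transform\<close>

lemma complex_vec_nth [simp]: "complex_vec x $ i = of_real (x $ i)"
  by (simp add: complex_vec_def)

lemma complex_mat_mult_nth: "(complex_mat A *v v) $ i = (\<Sum>j\<in>UNIV. of_real (A $ i $ j) * v $ j)"
  by (simp add: complex_mat_def map_matrix_def matrix_vector_mult_def)

lemma herm_inner_complex_vec: "herm_inner z (complex_vec x) = (\<Sum>i\<in>UNIV. z $ i * of_real (x $ i))"
  by (simp add: herm_inner_def)

lemma herm_inner_complex_vec_add:
  "herm_inner z (complex_vec (x + y)) = herm_inner z (complex_vec x) + herm_inner z (complex_vec y)"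
  by (simp add: herm_inner_complex_vec ring_distribs sum.distrib)

lemma herm_inner_complex_vec_diff:
  "herm_inner z (complex_vec (x - y)) = herm_inner z (complex_vec x) - herm_inner z (complex_vec y)"
  by (simp add: herm_inner_complex_vec right_diff_distrib sum_subtractf)

lemma herm_inner_complex_vec_scaleR:
  "herm_inner z (complex_vec (c *\<^sub>R x)) = of_real c * herm_inner z (complex_vec x)"
  by (simp add: herm_inner_complex_vec sum_distrib_left mult_ac)

lemma herm_inner_matrix_vector_mult:
  assumes "complex_mat (transpose A) *v z = c *s z"
  shows "herm_inner z (complex_vec (A *v x)) = c * herm_inner z (complex_vec x)"
proof -
  have "herm_inner z (complex_vec (A *v x)) = (\<Sum>i\<in>UNIV. \<Sum>j\<in>UNIV. z $ i * of_real (A $ i $ j) * of_real (x $ j))"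
    by (simp add: herm_inner_complex_vec matrix_vector_mult_def sum_distrib_left mult_ac)
  also have "\<dots> = (\<Sum>j\<in>UNIV. \<Sum>i\<in>UNIV. z $ i * of_real (A $ i $ j) * of_real (x $ j))"
    by (rule sum.swap)
  also have "\<dots> = (\<Sum>j\<in>UNIV. (complex_mat (transpose A) *v z) $ j * of_real (x $ j))"
    by (simp add: complex_mat_mult_nth transpose_def sum_distrib_left sum_distrib_right mult_ac)
  also have "\<dots> = c * herm_inner z (complex_vec x)"
    unfolding assms by (simp add: herm_inner_complex_vec sum_distrib_left mult_ac)
  finally show ?thesis .
qed

text \<open>At a coordinate of largest modulus, the eigenvector equation bounds the eigenvalue by a
  row sum. The bound is what lets the supremum in \<open>mat_spectral_radius\<close> dominate each
  eigenvalue.\<close>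

lemma bdd_above_complex_eigenvalues: "bdd_above (cmod ` complex_eigenvalues A)"
proof (rule bdd_aboveI2)
  fix c assume "c \<in> complex_eigenvalues A"
  then obtain v where v: "v \<noteq> 0" "complex_mat A *v v = c *s v"
    by (auto simp: complex_eigenvalues_def)
  define M where "M = Max (range (\<lambda>i. norm (v $ i)))"
  have le_M: "norm (v $ i) \<le> M" for i unfolding M_def by (intro Max_ge) auto
  have "M \<in> range (\<lambda>i. norm (v $ i))" unfolding M_def by (intro Max_in) auto
  then obtain i where i: "M = norm (v $ i)" by blast
  obtain i' where "v $ i' \<noteq> 0" using v(1) by (auto simp: vec_eq_iff)
  then have M: "M > 0" using le_M[of i'] by (smt (verit) zero_less_norm_iff)
  have "norm c * M = norm ((complex_mat A *v v) $ i)"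
    unfolding v(2) i by (simp add: norm_mult)
  also have "\<dots> \<le> (\<Sum>j\<in>UNIV. \<bar>A $ i $ j\<bar> * M)"
    unfolding complex_mat_mult_nth using le_M
    by (intro sum_norm_le) (simp add: norm_mult mult_left_mono)
  also have "\<dots> = (\<Sum>j\<in>UNIV. \<bar>A $ i $ j\<bar>) * M" by (simp add: sum_distrib_right)
  also have "\<dots> \<le> (\<Sum>i\<in>UNIV. \<Sum>j\<in>UNIV. \<bar>A $ i $ j\<bar>) * M"
    using M by (intro mult_right_mono member_le_sum) (auto intro: sum_nonneg)
  finally show "norm c \<le> (\<Sum>i\<in>UNIV. \<Sum>j\<in>UNIV. \<bar>A $ i $ j\<bar>)"
    using M by simp
qed

text \<open>Spectral radius below 1 excludes the eigenvalue 1, so \<open>mat 1 - A\<close> is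
  injective, hence surjective.\<close>

lemma ex_affine_fixed_point:
  fixes A :: "real^'n^'n"
  assumes "mat_spectral_radius A < 1"
  shows "\<exists>x. A *v x + b = x"
proof -
  have "x = 0" if "(mat 1 - A) *v x = 0" for x
  proof (rule ccontr)
    assume x: "x \<noteq> 0"
    have Ax: "A *v x = x" using that by (simp add: matrix_vector_mult_diff_rdistrib)
    have "complex_mat A *v complex_vec x = 1 *s complex_vec x"
    proof (rule vec_eq_iff[THEN iffD2, rule_format])
      fix i
      have "(complex_mat A *v complex_vec x) $ i = of_real ((A *v x) $ i)"
        unfolding complex_mat_mult_nth by (simp add: matrix_vector_mult_def)
      then show "(complex_mat A *v complex_vec x) $ i = (1 *s complex_vec x) $ i" by (simp add: Ax)
    qed
    moreover have "complex_vec x \<noteq> 0" using x by (auto simp: vec_eq_iff)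
    ultimately have "1 \<in> complex_eigenvalues A"
      unfolding complex_eigenvalues_def by blast
    then have "cmod 1 \<le> mat_spectral_radius A"
      unfolding mat_spectral_radius_def by (intro cSUP_upper bdd_above_complex_eigenvalues)
    then show False using assms by simp
  qed
  then have "\<exists>B. B ** (mat 1 - A) = mat 1" unfolding matrix_left_invertible_ker by blast
  then have "\<exists>B. (mat 1 - A) ** B = mat 1" using matrix_left_right_inverse by blast
  then have "surj ((*v) (mat 1 - A))" using matrix_right_invertible_surjective[of "mat 1 - A"] by blast
  then obtain x where "b = (mat 1 - A) *v x" by (rule surjE)
  then have "A *v x + b = x" by (simp add: matrix_vector_mult_diff_rdistrib)
  then show ?thesis ..
qed

text \<open>Otherwise a level set of the eigenfunctional \<open>z\<close> would be an invariant affine subspace.\<close>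

lemma irreducible_imp_herm_inner_nonzero:
  fixes A :: "real^'n^'n"
  assumes IFS: "homogeneous_affine_IFS A a m" and irr: "affinely_irreducible A a m"
    and z: "z \<noteq> 0" and eig: "complex_mat (transpose A) *v z = c *s z" and c: "c \<noteq> 0" "c \<noteq> 1"
  shows "\<exists>l\<in>{1..m}. herm_inner z (complex_vec (a l - a 1)) \<noteq> 0"
proof (rule ccontr)
  assume contra: "\<not> (\<exists>l\<in>{1..m}. herm_inner z (complex_vec (a l - a 1)) \<noteq> 0)"
  define h where "h x = herm_inner z (complex_vec x)" for x
  have al: "h (a l) = h (a 1)" if "l \<in> {1..m}" for l
  proof -
    have "herm_inner z (complex_vec (a l - a 1)) = 0" using contra that by blast
    then show ?thesis by (simp add: h_def herm_inner_complex_vec_diff)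
  qed
  have h_add: "h (x + y) = h x + h y" and h_scale: "h (t *\<^sub>R x) = of_real t * h x"
    and h_diff: "h (x - y) = h x - h y" and h_A: "h (A *v x) = c * h x" for x y t
    by (simp_all add: h_def herm_inner_complex_vec_add herm_inner_complex_vec_scaleR
        herm_inner_complex_vec_diff herm_inner_matrix_vector_mult[OF eig])
  \<comment> \<open>\<open>w\<close> solves \<open>w = c * w + h (a 1)\<close>. As
    \<open>h (a l)\<close> does not depend on \<open>l\<close>, every map sends the level set of
    \<open>w\<close> to itself.\<close>
  define w where "w = h (a 1) / (1 - c)"
  have "h (a 1) = (1 - c) * w" using c by (simp add: w_def)
  then have w: "h (a 1) = w - c * w" by (simp add: left_diff_distrib)
  define V where "V = {x. h x = w}"
  have "affine V"
    by (auto simp: affine_def V_def h_add h_scale simp flip: ring_distribs of_real_add)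
  \<comment> \<open>A complex-valued functional need not attain \<open>w\<close> on real vectors; it
    does so at the fixed point of the first map.\<close>
  moreover have "V \<noteq> {}"
  proof -
    obtain x where x: "A *v x + a 1 = x"
      using ex_affine_fixed_point[of A "a 1"] IFS by (auto simp: homogeneous_affine_IFS_def)
    then have "h x = c * h x + (w - c * w)" using h_add[of "A *v x" "a 1"] h_A w by simp
    then have "(1 - c) * (h x - w) = 0" by (simp add: algebra_simps)
    then have "x \<in> V" using c by (simp add: V_def)
    then show ?thesis by blast
  qed
  moreover have "V \<noteq> UNIV"
  proof
    assume "V = UNIV"
    then have V: "h x = w" for x by (auto simp: V_def)
    have "w = 0" using V[of 0] h_scale[of 0 0] by simp
    have "z $ i = 0" for i
    proof -
      have "h (axis i 1) = z $ i"
        by (simp add: h_def herm_inner_complex_vec axis_def if_distrib[of of_real] if_distrib[of "(*) _"] cong: if_cong)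
      then show ?thesis using V \<open>w = 0\<close> by simp
    qed
    then show False using z by (simp add: vec_eq_iff)
  qed
  moreover have "ifs_map A a l ` V = V" if l: "l \<in> {1..m}" for l
  proof
    show "ifs_map A a l ` V \<subseteq> V"
      using al[OF l] w by (auto simp: V_def ifs_map_def h_add h_A)
    show "V \<subseteq> ifs_map A a l ` V"
    proof
      fix y assume y: "y \<in> V"
      have "invertible A" using IFS by (simp add: homogeneous_affine_IFS_def)
      then obtain B where "A ** B = mat 1" by (auto simp: invertible_def)
      then have AB: "A *v (B *v v) = v" for v by (simp add: matrix_vector_mul_assoc)
      let ?x = "B *v (y - a l)"
      have "c * h ?x = h (y - a l)" by (simp add: AB flip: h_A)
      also have "\<dots> = c * w" using y al[OF l] w by (simp add: h_diff V_def)
      finally have "?x \<in> V" using c by (simp add: V_def)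
      moreover have "ifs_map A a l ?x = y" by (simp add: ifs_map_def AB)
      ultimately show "y \<in> ifs_map A a l ` V" by (metis imageI)
    qed
  qed
  ultimately have "affine V \<and> V \<noteq> {} \<and> V \<noteq> UNIV \<and> (\<forall>l\<in>{1..m}. ifs_map A a l ` V = V)"
    by (intro conjI ballI)
  then have "\<exists>V. affine V \<and> V \<noteq> {} \<and> V \<noteq> UNIV \<and> (\<forall>l\<in>{1..m}. ifs_map A a l ` V = V)"
    by (rule exI)
  with irr show False unfolding affinely_irreducible_def by (rule notE)
qed

section \<open>Self-affine measures and their Fourier transforms\<close>

lemma sum_ennreal_mult:
  assumes "\<And>l. l \<in> L \<Longrightarrow> p l \<ge> 0" "\<And>l. l \<in> L \<Longrightarrow> x l \<ge> 0"
  shows "(\<Sum>l\<in>L. ennreal (p l) * ennreal (x l)) = ennreal (\<Sum>l\<in>L. p l * x l)"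
proof -
  have "(\<Sum>l\<in>L. ennreal (p l) * ennreal (x l)) = (\<Sum>l\<in>L. ennreal (p l * x l))"
    using assms by (intro sum.cong refl) (simp add: ennreal_mult)
  also have "\<dots> = ennreal (\<Sum>l\<in>L. p l * x l)"
    using assms by (intro sum_ennreal mult_nonneg_nonneg)
  finally show ?thesis .
qed

lemma self_affine_nn_integral:
  assumes \<mu>: "self_affine_measure A a m p \<mu>" and p: "strictly_positive_prob_vector m p"
    and f: "f \<in> borel_measurable borel"
  shows "(\<integral>\<^sup>+x. f x \<partial>\<mu>) = (\<Sum>l=1..m. ennreal (p l) * (\<integral>\<^sup>+x. f (ifs_map A a l x) \<partial>\<mu>))"
proof -
  interpret prob_space \<mu> using \<mu> by (simp add: self_affine_measure_def)
  have sets [measurable_cong]: "sets \<mu> = sets borel" using \<mu> by (simp add: self_affine_measure_def)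
  have space: "space \<mu> = UNIV" using sets_eq_imp_space_eq[OF sets] by simp
  have pos: "p l \<ge> 0" if "l \<in> {1..m}" for l
    using p that by (auto simp: strictly_positive_prob_vector_def less_imp_le)
  have \<phi> [measurable]: "ifs_map A a l \<in> borel_measurable borel" for l
    unfolding ifs_map_def by (intro borel_measurable_continuous_onI continuous_intros matrix_vector_mult_linear_continuous_on)
  show ?thesis
    using f
  proof (induction rule: borel_measurable_induct)
    case (cong f g)
    then show ?case by simp
  next
    case (set B)
    then have vimage: "ifs_map A a l -` B \<in> sets \<mu>" for l
      using measurable_sets[OF \<phi>, of B l] by (simp add: sets)
    have "(\<integral>\<^sup>+x. indicator B x \<partial>\<mu>) = ennreal (measure \<mu> B)"
      using set by (simp add: sets emeasure_eq_measure)
    also have "measure \<mu> B = (\<Sum>l=1..m. p l * measure \<mu> (ifs_map A a l -` B))"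
      using \<mu> set by (simp add: self_affine_measure_def)
    also have "ennreal \<dots> = (\<Sum>l=1..m. ennreal (p l) * ennreal (measure \<mu> (ifs_map A a l -` B)))"
      using pos by (intro sum_ennreal_mult[symmetric]) auto
    also have "\<dots> = (\<Sum>l=1..m. ennreal (p l) * (\<integral>\<^sup>+x. indicator B (ifs_map A a l x) \<partial>\<mu>))"
    proof (intro sum.cong refl arg_cong2[where f = "(*)"])
      fix l
      have "(\<integral>\<^sup>+x. indicator B (ifs_map A a l x) \<partial>\<mu>) = (\<integral>\<^sup>+x. indicator (ifs_map A a l -` B) x \<partial>\<mu>)"
        by (simp add: indicator_def)
      also have "\<dots> = ennreal (measure \<mu> (ifs_map A a l -` B))"
        using vimage by (simp add: emeasure_eq_measure)
      finally show "ennreal (measure \<mu> (ifs_map A a l -` B)) = (\<integral>\<^sup>+x. indicator B (ifs_map A a l x) \<partial>\<mu>)" ..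
    qed
    finally show ?case .
  next
    case (mult u c)
    then have [measurable]: "u \<in> borel_measurable borel" by simp
    show ?case using mult by (simp add: nn_integral_cmult sum_distrib_left mult_ac)
  next
    case (add u v)
    then have [measurable]: "u \<in> borel_measurable borel" "v \<in> borel_measurable borel" by simp_all
    show ?case using add by (simp add: nn_integral_add sum.distrib ring_distribs)
  next
    case (seq U)
    then have [measurable]: "U i \<in> borel_measurable borel" for i by simp
    have "(\<integral>\<^sup>+x. (SUP i. U i) x \<partial>\<mu>) = (SUP i. \<integral>\<^sup>+x. U i x \<partial>\<mu>)"
      unfolding SUP_apply using seq by (intro nn_integral_monotone_convergence_SUP) auto
    also have "\<dots> = (SUP i. \<Sum>l=1..m. ennreal (p l) * (\<integral>\<^sup>+x. U i (ifs_map A a l x) \<partial>\<mu>))"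
      using seq by simp
    also have "\<dots> = (\<Sum>l=1..m. SUP i. ennreal (p l) * (\<integral>\<^sup>+x. U i (ifs_map A a l x) \<partial>\<mu>))"
      using seq by (intro ennreal_SUP_sum) (auto simp: mono_def le_fun_def intro!: mult_left_mono nn_integral_mono)
    also have "\<dots> = (\<Sum>l=1..m. ennreal (p l) * (\<integral>\<^sup>+x. (SUP i. U i) (ifs_map A a l x) \<partial>\<mu>))"
    proof (intro sum.cong refl)
      fix l
      have "(\<integral>\<^sup>+x. (SUP i. U i) (ifs_map A a l x) \<partial>\<mu>) = (SUP i. \<integral>\<^sup>+x. U i (ifs_map A a l x) \<partial>\<mu>)"
        unfolding SUP_apply using seq
        by (intro nn_integral_monotone_convergence_SUP) (auto simp: mono_def le_fun_def)
      then show "(SUP i. ennreal (p l) * (\<integral>\<^sup>+x. U i (ifs_map A a l x) \<partial>\<mu>))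
          = ennreal (p l) * (\<integral>\<^sup>+x. (SUP i. U i) (ifs_map A a l x) \<partial>\<mu>)"
        by (simp add: SUP_mult_left_ennreal)
    qed
    finally show ?case .
  qed
qed

text \<open>Adding \<open>B\<close> makes \<open>f\<close> nonnegative; \<open>B\<close> cancels
  afterwards because the weights add up to 1.\<close>

lemma self_affine_integral_real:
  fixes f :: "real^'n \<Rightarrow> real"
  assumes \<mu>: "self_affine_measure A a m p \<mu>" and p: "strictly_positive_prob_vector m p"
    and f [measurable]: "f \<in> borel_measurable borel" and bound: "\<And>x. \<bar>f x\<bar> \<le> B"
  shows "(LINT x|\<mu>. f x) = (\<Sum>l=1..m. p l * (LINT x|\<mu>. f (ifs_map A a l x)))"
proof -
  interpret prob_space \<mu> using \<mu> by (simp add: self_affine_measure_def)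
  have sets [measurable_cong]: "sets \<mu> = sets borel" using \<mu> by (simp add: self_affine_measure_def)
  have pos: "p l \<ge> 0" if "l \<in> {1..m}" for l
    using p that by (auto simp: strictly_positive_prob_vector_def less_imp_le)
  have \<phi> [measurable]: "ifs_map A a l \<in> borel_measurable borel" for l
    unfolding ifs_map_def by (intro borel_measurable_continuous_onI continuous_intros matrix_vector_mult_linear_continuous_on)
  have f0: "f x + B \<ge> 0" for x using bound[of x] by linarith
  have int: "integrable \<mu> g" if [measurable]: "g \<in> borel_measurable borel" and "\<And>x. \<bar>g x\<bar> \<le> C" for g :: "real^'n \<Rightarrow> real" and C
    using that(2) by (intro integrable_const_bound[of _ C]) auto
  have int_f: "integrable \<mu> (\<lambda>x. f (ifs_map A a l x))" for l
    using bound by (intro int[of _ B]) auto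
  have int_f': "integrable \<mu> f" using bound by (intro int[of _ B]) auto
  have "ennreal (LINT x|\<mu>. f x + B) = (\<integral>\<^sup>+x. ennreal (f x + B) \<partial>\<mu>)"
    using f0 int_f' by (intro nn_integral_eq_integral[symmetric]) auto
  also have "\<dots> = (\<Sum>l=1..m. ennreal (p l) * (\<integral>\<^sup>+x. ennreal (f (ifs_map A a l x) + B) \<partial>\<mu>))"
    by (rule self_affine_nn_integral[OF \<mu> p]) measurable
  also have "\<dots> = (\<Sum>l=1..m. ennreal (p l) * ennreal (LINT x|\<mu>. f (ifs_map A a l x) + B))"
    using f0 int_f by (intro sum.cong refl arg_cong2[where f = "(*)"] nn_integral_eq_integral) auto
  also have "\<dots> = ennreal (\<Sum>l=1..m. p l * (LINT x|\<mu>. f (ifs_map A a l x) + B))"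
    using pos f0 by (intro sum_ennreal_mult integral_nonneg) auto
  finally have "(LINT x|\<mu>. f x + B) = (\<Sum>l=1..m. p l * (LINT x|\<mu>. f (ifs_map A a l x) + B))"
    using pos f0 by (subst (asm) ennreal_inj) (auto intro!: integral_nonneg sum_nonneg mult_nonneg_nonneg)
  moreover have "(\<Sum>l=1..m. p l) = 1" using p by (simp add: strictly_positive_prob_vector_def)
  ultimately show ?thesis
    using int_f int_f' by (simp add: prob_space ring_distribs sum.distrib flip: sum_distrib_right)
qed

lemma fourier_transform_altdef: "fourier_transform \<mu> \<xi> = (LINT x|\<mu>. unit_exp (\<xi> \<bullet> x))"
  unfolding fourier_transform_def unit_exp_def cis_conv_exp by (simp add: mult_ac)

text \<open>Invariance is applied to the real and imaginary parts of a character. The translations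
  give unimodular factors; the linear part, common to all maps, moves to the frequency, so the
  transform factors out.\<close>

lemma fourier_transform_self_affine:
  assumes \<mu>: "self_affine_measure A a m p \<mu>" and p: "strictly_positive_prob_vector m p"
  shows "fourier_transform \<mu> \<xi> =
    (\<Sum>l=1..m. of_real (p l) * unit_exp (\<xi> \<bullet> a l)) * fourier_transform \<mu> (transpose A *v \<xi>)"
proof -
  interpret prob_space \<mu> using \<mu> by (simp add: self_affine_measure_def)
  have sets [measurable_cong]: "sets \<mu> = sets borel" using \<mu> by (simp add: self_affine_measure_def)
  have [measurable]: "(\<lambda>x. unit_exp (\<xi> \<bullet> x)) \<in> borel_measurable borel" for \<xi> :: "real^'n"
    unfolding unit_exp_def by (intro borel_measurable_continuous_onI continuous_intros)
  have \<phi> [measurable]: "ifs_map A a l \<in> borel_measurable borel" for l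
    unfolding ifs_map_def by (intro borel_measurable_continuous_onI continuous_intros matrix_vector_mult_linear_continuous_on)
  have int: "integrable \<mu> (\<lambda>x. unit_exp (\<xi> \<bullet> x))" for \<xi>
    by (intro integrable_const_bound[of _ 1]) auto
  have int': "integrable \<mu> (\<lambda>x. unit_exp (\<xi> \<bullet> ifs_map A a l x))" for l
    by (intro integrable_const_bound[of _ 1]) auto
  have "fourier_transform \<mu> \<xi> = (\<Sum>l=1..m. of_real (p l) * (LINT x|\<mu>. unit_exp (\<xi> \<bullet> ifs_map A a l x)))"
  proof (rule complex_eqI)
    have "(LINT x|\<mu>. Re (unit_exp (\<xi> \<bullet> x))) = (\<Sum>l=1..m. p l * (LINT x|\<mu>. Re (unit_exp (\<xi> \<bullet> ifs_map A a l x))))"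
      by (rule self_affine_integral_real[OF \<mu> p, of _ 1]) (auto simp: unit_exp_def)
    then show "Re (fourier_transform \<mu> \<xi>) = Re (\<Sum>l=1..m. of_real (p l) * (LINT x|\<mu>. unit_exp (\<xi> \<bullet> ifs_map A a l x)))"
      using int int' by (simp add: fourier_transform_altdef)
    have "(LINT x|\<mu>. Im (unit_exp (\<xi> \<bullet> x))) = (\<Sum>l=1..m. p l * (LINT x|\<mu>. Im (unit_exp (\<xi> \<bullet> ifs_map A a l x))))"
      by (rule self_affine_integral_real[OF \<mu> p, of _ 1]) (auto simp: unit_exp_def)
    then show "Im (fourier_transform \<mu> \<xi>) = Im (\<Sum>l=1..m. of_real (p l) * (LINT x|\<mu>. unit_exp (\<xi> \<bullet> ifs_map A a l x)))"
      using int int' by (simp add: fourier_transform_altdef)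
  qed
  moreover have "(LINT x|\<mu>. unit_exp (\<xi> \<bullet> ifs_map A a l x))
      = unit_exp (\<xi> \<bullet> a l) * fourier_transform \<mu> (transpose A *v \<xi>)" for l
  proof -
    have "unit_exp (\<xi> \<bullet> ifs_map A a l x) = unit_exp (\<xi> \<bullet> a l) * unit_exp ((transpose A *v \<xi>) \<bullet> x)" for x
    proof -
      have "\<xi> \<bullet> ifs_map A a l x = \<xi> \<bullet> a l + (transpose A *v \<xi>) \<bullet> x"
        by (simp add: ifs_map_def inner_add_right flip: dot_lmul_matrix)
      then show ?thesis by (simp add: unit_exp_add)
    qed
    then show ?thesis by (simp add: fourier_transform_altdef)
  qed
  ultimately show ?thesis by (simp only: sum_distrib_right mult.assoc)
qed

lemma fourier_transform_tendsto_1: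
  fixes \<mu> :: "(real^'n) measure" and \<xi> :: "nat \<Rightarrow> real^'n"
  assumes "prob_space \<mu>" and sets: "sets \<mu> = sets borel" and lim: "\<xi> \<longlonglongrightarrow> 0"
  shows "(\<lambda>n. fourier_transform \<mu> (\<xi> n)) \<longlonglongrightarrow> 1"
proof -
  interpret prob_space \<mu> by fact
  note [measurable_cong] = sets
  have [measurable]: "(\<lambda>x. unit_exp (\<xi> \<bullet> x)) \<in> borel_measurable borel" for \<xi> :: "real^'n"
    unfolding unit_exp_def by (intro borel_measurable_continuous_onI continuous_intros)
  have "(\<lambda>n. LINT x|\<mu>. unit_exp (\<xi> n \<bullet> x)) \<longlonglongrightarrow> (LINT x|\<mu>. 1)"
  proof (rule integral_dominated_convergence[where w = "\<lambda>_. 1"])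
    show "AE x in \<mu>. (\<lambda>n. unit_exp (\<xi> n \<bullet> x)) \<longlonglongrightarrow> 1"
    proof (rule AE_I2)
      fix x
      have "(\<lambda>n. unit_exp (\<xi> n \<bullet> x)) \<longlonglongrightarrow> unit_exp (0 \<bullet> x)"
        unfolding unit_exp_def by (intro tendsto_intros lim)
      then show "(\<lambda>n. unit_exp (\<xi> n \<bullet> x)) \<longlonglongrightarrow> 1" by (simp add: unit_exp_def)
    qed
  qed auto
  then show ?thesis by (simp add: fourier_transform_altdef prob_space)
qed

section \<open>Products of factors close to 1, and the frequencies\<close>

text \<open>Summable defects keep a product of positive factors away from 0. Logarithms are avoided
  by an invariant lower bound.\<close>

lemma recursive_product_bounded_below:
  fixes b t :: "nat \<Rightarrow> real"
  assumes rec: "\<And>n. b (Suc n) = t n * b n" and b0: "b 0 > 0" and t: "\<And>n. t n > 0"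
    and near: "\<And>n. t n \<ge> 1 - C * \<rho> ^ n" and \<rho>: "0 < \<rho>" "\<rho> < 1" and C: "C \<ge> 0"
  shows "\<exists>c>0. \<forall>n. b n \<ge> c"
proof -
  have b: "b n > 0" for n by (induction n) (simp_all add: b0 rec t)
  define K where "K = C / (1 - \<rho>)"
  have K: "K \<ge> 0" "C = K * (1 - \<rho>)" using C \<rho> by (simp_all add: K_def)
  have "(\<lambda>n. K * \<rho> ^ n) \<longlonglongrightarrow> K * 0"
    using \<rho> by (intro tendsto_mult_left LIMSEQ_power_zero) auto
  then have "\<forall>\<^sub>F n in sequentially. K * \<rho> ^ n < 1/2" by (intro order_tendstoD) auto
  then obtain N where N: "\<And>n. n \<ge> N \<Longrightarrow> K * \<rho> ^ n < 1/2" by (auto simp: eventually_sequentially)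
  \<comment> \<open>With \<open>e = K * \<rho> ^ (N + j)\<close> the defect of the next factor is at
    most \<open>e * (1 - \<rho>)\<close> by the choice of \<open>K\<close>. As
    \<open>1/2 + e \<le> 1\<close> by the choice of \<open>N\<close>, multiplication lowers
    \<open>1/2 + e\<close> by no more than that, so at worst to
    \<open>1/2 + e * \<rho>\<close>.\<close>
  have tail: "b (N + j) \<ge> b N * (1/2 + K * \<rho> ^ (N + j))" for j
  proof (induction j)
    case 0
    then show ?case using N[of N] b[of N] by (simp add: mult_le_cancel_left1)
  next
    case (Suc j)
    define e where "e = K * \<rho> ^ (N + j)"
    have e: "0 \<le> e" "e \<le> 1/2" using N[of "N + j"] K \<rho> by (simp_all add: e_def)
    have step: "1/2 + e * \<rho> \<le> (1 - e * (1 - \<rho>)) * (1/2 + e)"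
    proof -
      have "(1 - e * (1 - \<rho>)) * (1/2 + e) - (1/2 + e * \<rho>) = e * (1 - \<rho>) * (1/2 - e)"
        by (simp add: field_simps)
      also have "\<dots> \<ge> 0" using e \<rho> by simp
      finally show ?thesis by simp
    qed
    have te: "1 - e * (1 - \<rho>) \<le> t (N + j)"
      using near[of "N + j"] K(2) by (simp add: e_def mult_ac)
    have "b N * (1/2 + e * \<rho>) \<le> b N * ((1 - e * (1 - \<rho>)) * (1/2 + e))"
      using step b[of N] by (intro mult_left_mono) auto
    also have "\<dots> \<le> b N * (t (N + j) * (1/2 + e))"
      using te e b[of N] by (intro mult_left_mono mult_right_mono) auto
    also have "\<dots> = t (N + j) * (b N * (1/2 + e))" by simp
    also have "\<dots> \<le> t (N + j) * b (N + j)"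
      using Suc t[of "N + j"] by (intro mult_left_mono) (auto simp: e_def)
    finally show ?case by (simp add: rec e_def mult_ac)
  qed
  define c where "c = Min (insert (b N / 2) (b ` {..<N}))"
  have "c > 0" unfolding c_def using b by (subst Min_gr_iff) auto
  moreover have "b n \<ge> c" for n
  proof (cases "n < N")
    case True
    then show ?thesis unfolding c_def by (intro Min_le) auto
  next
    case False
    have "c \<le> b N / 2" unfolding c_def by (intro Min_le) auto
    also have "\<dots> \<le> b N * (1/2 + K * \<rho> ^ n)" using b[of N] K \<rho> by (simp add: ring_distribs)
    also have "\<dots> \<le> b n" using tail[of "n - N"] False by simp
    finally show ?thesis .
  qed
  ultimately show ?thesis by blast
qed

lemma tendsto_sum_mset:
  fixes f :: "'a \<Rightarrow> 'b \<Rightarrow> 'c :: topological_comm_monoid_add"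
  assumes "\<And>x. x \<in># A \<Longrightarrow> (f x \<longlongrightarrow> l x) F"
  shows "((\<lambda>y. \<Sum>x\<in>#A. f x y) \<longlongrightarrow> (\<Sum>x\<in>#A. l x)) F"
  using assms by (induction A) (auto intro!: tendsto_add)

text \<open>\<open>Z r\<close> stands for an eigenvector attached to the root \<open>r\<close>. The
  \<open>Z r\<close> need not respect conjugation, so real parts are taken coordinatewise; this
  commutes with real matrices and with pairing against real vectors.\<close>

definition real_frequency :: "int poly \<Rightarrow> (complex \<Rightarrow> complex^'n) \<Rightarrow> int poly \<Rightarrow> int \<Rightarrow> real^'n" where
  "real_frequency G Z Q k = (\<chi> i. Re (\<Sum>r\<in>#filter_mset (\<lambda>r. norm r > 1) (complex_roots G).
     r powi k * int_poly_eval Q r * Z r $ i))"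

lemma real_frequency_inner:
  assumes "\<And>r. r \<in># complex_roots G \<Longrightarrow> norm r > 1 \<Longrightarrow> herm_inner (Z r) (complex_vec x) = int_poly_eval P r"
  shows "real_frequency G Z Q k \<bullet> x = outer_trace G k (Q * P)"
proof -
  let ?O = "filter_mset (\<lambda>r. norm r > 1) (complex_roots G)"
  have "real_frequency G Z Q k \<bullet> x
      = Re (\<Sum>i\<in>UNIV. \<Sum>r\<in>#?O. r powi k * int_poly_eval Q r * Z r $ i * of_real (x $ i))"
    by (simp add: real_frequency_def inner_vec_def flip: sum_mset_distrib_right)
  also have "(\<Sum>i\<in>UNIV. \<Sum>r\<in>#?O. r powi k * int_poly_eval Q r * Z r $ i * of_real (x $ i))
      = (\<Sum>r\<in>#?O. \<Sum>i\<in>UNIV. r powi k * int_poly_eval Q r * Z r $ i * of_real (x $ i))"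
    by (rule sum_mset_sum_swap[symmetric])
  also have "\<dots> = (\<Sum>r\<in>#?O. r powi k * int_poly_eval (Q * P) r)"
  proof (intro arg_cong[where f = sum_mset] image_mset_cong)
    fix r assume "r \<in># ?O"
    then have "int_poly_eval P r = herm_inner (Z r) (complex_vec x)" using assms by simp
    then show "(\<Sum>i\<in>UNIV. r powi k * int_poly_eval Q r * Z r $ i * of_real (x $ i)) = r powi k * int_poly_eval (Q * P) r"
      by (simp add: herm_inner_complex_vec sum_distrib_left mult.assoc)
  qed
  finally show ?thesis by (simp add: outer_trace_def)
qed

lemma transpose_mult_real_frequency:
  assumes "\<And>r. r \<in># complex_roots G \<Longrightarrow> norm r > 1 \<Longrightarrow> complex_mat (transpose A) *v Z r = inverse r *s Z r"
  shows "transpose A *v real_frequency G Z Q k = real_frequency G Z Q (k - 1)"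
proof (rule vec_eq_iff[THEN iffD2, rule_format])
  fix i
  let ?O = "filter_mset (\<lambda>r. norm r > 1) (complex_roots G)"
  let ?B = "transpose A"
  have "(?B *v real_frequency G Z Q k) $ i
      = Re (\<Sum>j\<in>UNIV. \<Sum>r\<in>#?O. of_real (?B $ i $ j) * (r powi k * int_poly_eval Q r * Z r $ j))"
    by (simp add: real_frequency_def matrix_vector_mult_def flip: sum_mset_distrib_left)
  also have "(\<Sum>j\<in>UNIV. \<Sum>r\<in>#?O. of_real (?B $ i $ j) * (r powi k * int_poly_eval Q r * Z r $ j))
      = (\<Sum>r\<in>#?O. \<Sum>j\<in>UNIV. of_real (?B $ i $ j) * (r powi k * int_poly_eval Q r * Z r $ j))"
    by (rule sum_mset_sum_swap[symmetric])
  also have "\<dots> = (\<Sum>r\<in>#?O. r powi (k - 1) * int_poly_eval Q r * Z r $ i)"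
  proof (intro arg_cong[where f = sum_mset] image_mset_cong)
    fix r assume r: "r \<in># ?O"
    then have "r \<noteq> 0" by auto
    have "(\<Sum>j\<in>UNIV. of_real (?B $ i $ j) * (r powi k * int_poly_eval Q r * Z r $ j))
        = r powi k * int_poly_eval Q r * (complex_mat ?B *v Z r) $ i"
      by (simp add: complex_mat_mult_nth sum_distrib_left mult_ac)
    also have "(complex_mat ?B *v Z r) $ i = inverse r * Z r $ i"
      using assms r by simp
    also have "r powi k * int_poly_eval Q r * (inverse r * Z r $ i) = r powi (k - 1) * int_poly_eval Q r * Z r $ i"
      using \<open>r \<noteq> 0\<close> by (simp add: power_int_diff field_simps)
    finally show "(\<Sum>j\<in>UNIV. of_real (?B $ i $ j) * (r powi k * int_poly_eval Q r * Z r $ j))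
        = r powi (k - 1) * int_poly_eval Q r * Z r $ i" .
  qed
  finally show "(?B *v real_frequency G Z Q k) $ i = real_frequency G Z Q (k - 1) $ i"
    by (simp add: real_frequency_def)
qed

lemma real_frequency_tendsto_0:
  fixes Z :: "complex \<Rightarrow> complex^'n"
  shows "(\<lambda>n. real_frequency G Z Q (- int n)) \<longlonglongrightarrow> 0"
proof (rule vec_tendstoI)
  fix i
  let ?O = "filter_mset (\<lambda>r. norm r > 1) (complex_roots G)"
  have "(\<lambda>n. \<Sum>r\<in>#?O. inverse r ^ n * (int_poly_eval Q r * Z r $ i)) \<longlonglongrightarrow> (\<Sum>r\<in>#?O. 0 * (int_poly_eval Q r * Z r $ i))"
  proof (intro tendsto_sum_mset tendsto_mult_right LIMSEQ_power_zero)
    fix r assume "r \<in># ?O"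
    then show "norm (inverse r) < 1" by (simp add: norm_inverse inverse_less_1_iff)
  qed
  then have "(\<lambda>n. Re (\<Sum>r\<in>#?O. inverse r ^ n * (int_poly_eval Q r * Z r $ i))) \<longlonglongrightarrow> Re 0"
    by (intro tendsto_Re) simp
  then show "(\<lambda>n. real_frequency G Z Q (- int n) $ i) \<longlonglongrightarrow> (0 :: real^'n) $ i"
    by (simp add: real_frequency_def power_int_minus power_inverse mult.assoc)
qed

text \<open>A root 0 could be divided out: the quotient still vanishes on \<open>S\<close>, whose
  members are nonzero, and would be a witness of smaller degree.\<close>

lemma minimal_pisot_witness_root_nonzero:
  assumes P: "pisot_witness S P" and min: "\<And>Q. pisot_witness S Q \<Longrightarrow> degree P \<le> degree Q"
    and S: "\<And>b. b \<in> S \<Longrightarrow> norm b > 1" and r: "int_poly_eval P r = 0"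
  shows "r \<noteq> 0"
proof
  assume "r = 0"
  obtain c P1 where P1: "P = pCons c P1" by (cases P)
  have "c = 0" using r unfolding P1 \<open>r = 0\<close> by simp
  then have P1: "P = pCons 0 P1" using P1 by simp
  have eval: "int_poly_eval P z = z * int_poly_eval P1 z" for z by (simp add: P1)
  have "P1 \<noteq> 0" using P unfolding P1 by (auto simp: pisot_witness_def)
  have "pisot_witness S P1"
    unfolding pisot_witness_def
  proof (intro conjI ballI allI impI)
    show "lead_coeff P1 = 1" using P \<open>P1 \<noteq> 0\<close> unfolding P1 by (simp add: pisot_witness_def)
    show "int_poly_eval P1 b = 0" if b: "b \<in> S" for b
    proof -
      have "b * int_poly_eval P1 b = 0" using P b unfolding pisot_witness_def eval by blast
      moreover have "b \<noteq> 0" using S[OF b] by auto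
      ultimately show ?thesis by simp
    qed
    show "norm z < 1" if "int_poly_eval P1 z = 0 \<and> z \<notin> S" for z
      using P that unfolding pisot_witness_def eval by simp
  qed
  then have "degree P \<le> degree P1" by (rule min)
  then show False unfolding P1 using \<open>P1 \<noteq> 0\<close> by simp
qed

theorem theorem1p13:
  fixes A :: "real^'n^'n" and a :: "nat \<Rightarrow> real^'n" and m :: nat
    and p :: "nat \<Rightarrow> real" and \<mu> :: "(real^'n) measure"
  assumes "generalized_pisot_IFS_type_I A a m"
    and "affinely_irreducible A a m"
    and "strictly_positive_prob_vector m p"
    and "self_affine_measure A a m p \<mu>"
  shows "\<not> rajchman \<mu>"
proof
  assume raj: "rajchman \<mu>"
  have IFS: "homogeneous_affine_IFS A a m"
    using assms(1) by (simp add: generalized_pisot_IFS_type_I_def)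
  obtain k :: nat and \<beta> \<zeta> where \<zeta>: "\<And>j. j \<in> {1..k} \<Longrightarrow> \<zeta> j \<noteq> 0"
    and type_I: "pisot_tuple_type_I (\<beta> ` {1..k})"
    and eig: "\<And>j. j \<in> {1..k} \<Longrightarrow> complex_mat (transpose A) *v \<zeta> j = inverse (\<beta> j) *s \<zeta> j"
    and Pex: "\<And>l. l \<in> {1..m} \<Longrightarrow> \<exists>P. \<forall>j\<in>{1..k}.
           herm_inner (\<zeta> j) (complex_vec (a l - a 1)) = int_poly_eval P (\<beta> j)"
    using assms(1) unfolding generalized_pisot_IFS_type_I_def by metis
  define S where "S = \<beta> ` {1..k}"
  have S_gt: "norm b > 1" if "b \<in> S" for b
    using type_I that unfolding pisot_tuple_type_I_def pisot_tuple_def S_def by blast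
  obtain P \<gamma> where P: "pisot_witness S P" "\<And>Q. pisot_witness S Q \<Longrightarrow> degree P \<le> degree Q"
    and \<gamma>: "int_poly_eval P \<gamma> = 0" "norm \<gamma> < 1"
    using type_I unfolding pisot_tuple_type_I_def S_def[symmetric] by blast
  have "lead_coeff P = 1" using P(1) by (simp add: pisot_witness_def)
  from ex_monic_minimal_int_poly[OF this \<gamma>(1)] obtain G where G: "lead_coeff G = 1" "int_poly_eval G \<gamma> = 0"
    "\<And>z. int_poly_eval G z = 0 \<Longrightarrow> int_poly_eval P z = 0"
    "\<And>h. int_poly_eval h \<gamma> = 0 \<Longrightarrow> degree h < degree G \<Longrightarrow> h = 0"
    "\<And>h z. int_poly_eval h \<gamma> = 0 \<Longrightarrow> int_poly_eval G z = 0 \<Longrightarrow> int_poly_eval h z = 0"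
    by metis
  \<comment> \<open>Roots of \<open>G\<close> are roots of the witness \<open>P\<close>. So
    \<open>G\<close> has no root on the unit circle, and its outer roots belong to the tuple and
    carry eigenvectors.\<close>
  have in_S: "r \<in> S \<or> norm r < 1" if "int_poly_eval G r = 0" for r
    using P(1) G(3)[OF that] unfolding pisot_witness_def by blast
  interpret hyperbolic_minimal_poly G \<gamma>
  proof
    show "r \<noteq> 0 \<and> norm r \<noteq> 1" if "int_poly_eval G r = 0" for r
    proof
      show "r \<noteq> 0" by (rule minimal_pisot_witness_root_nonzero[OF P S_gt G(3)[OF that]])
      show "norm r \<noteq> 1" using in_S[OF that] S_gt by force
    qed
  qed (fact G \<gamma>)+
  have outer_S: "r \<in> S" if "r \<in># Outer" for r
    using in_S[of r] that by (auto simp: in_Roots)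
  have "\<forall>r\<in>S. \<exists>j\<in>{1..k}. \<beta> j = r" by (auto simp: S_def)
  then obtain idx where idx: "\<And>r. r \<in> S \<Longrightarrow> idx r \<in> {1..k}" "\<And>r. r \<in> S \<Longrightarrow> \<beta> (idx r) = r"
    by metis
  define Z where "Z r = \<zeta> (idx r)" for r
  have Z_eig: "complex_mat (transpose A) *v Z r = inverse r *s Z r" if "r \<in> S" for r
    using eig[OF idx(1)[OF that]] idx(2)[OF that] by (simp add: Z_def)
  obtain Pl where "\<And>l j. l \<in> {1..m} \<Longrightarrow> j \<in> {1..k} \<Longrightarrow>
      herm_inner (\<zeta> j) (complex_vec (a l - a 1)) = int_poly_eval (Pl l) (\<beta> j)"
    using Pex by metis
  then have Pl: "herm_inner (Z r) (complex_vec (a l - a 1)) = int_poly_eval (Pl l) r"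
    if "l \<in> {1..m}" "r \<in> S" for l r
    using that idx[OF that(2)] by (simp add: Z_def)
  have pos: "p l > 0" if "l \<in> {1..m}" for l
    using assms(3) that by (simp add: strictly_positive_prob_vector_def)
  have sum_p: "(\<Sum>l=1..m. p l) = 1"
    using assms(3) by (simp add: strictly_positive_prob_vector_def)
  have "{1..m} \<noteq> {}" using IFS by (simp add: homogeneous_affine_IFS_def)
  from ex_multiplier_nonvanishing[OF finite_atLeastAtMost this, of p Pl] pos
  obtain Q where Q: "int_poly_eval Q \<gamma> \<noteq> 0"
    "\<And>k. (\<Sum>l=1..m. of_real (p l) * unit_exp (tr k (Q * Pl l))) \<noteq> 0"
    by blast
  define \<xi> where "\<xi> = real_frequency G Z Q"
  have \<xi>_step: "transpose A *v \<xi> k = \<xi> (k - 1)" for k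
    unfolding \<xi>_def by (rule transpose_mult_real_frequency) (simp add: Z_eig outer_S)
  have \<xi>_inner: "\<xi> k \<bullet> (a l - a 1) = tr k (Q * Pl l)" if "l \<in> {1..m}" for k l
    unfolding \<xi>_def by (rule real_frequency_inner) (rule Pl[OF that outer_S], simp)
  define t where "t k = norm (\<Sum>l=1..m. of_real (p l) * unit_exp (tr k (Q * Pl l)))" for k
  have t_pos: "t k > 0" for k using Q(2) by (simp add: t_def)
  define F where "F k = norm (fourier_transform \<mu> (\<xi> k))" for k
  \<comment> \<open>Factoring out the unimodular \<open>unit_exp (\<xi> k \<bullet> a 1)\<close>
    leaves differences of translations, whose pairings with \<open>\<xi> k\<close> are outer
    traces.\<close>
  have F_step: "F k = t k * F (k - 1)" for k
  proof -
    have "(\<Sum>l=1..m. of_real (p l) * unit_exp (\<xi> k \<bullet> a l))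
        = unit_exp (\<xi> k \<bullet> a 1) * (\<Sum>l=1..m. of_real (p l) * unit_exp (tr k (Q * Pl l)))"
      unfolding sum_distrib_left
    proof (intro sum.cong refl)
      fix l assume "l \<in> {1..m}"
      then have "\<xi> k \<bullet> a l = \<xi> k \<bullet> a 1 + tr k (Q * Pl l)"
        using \<xi>_inner[of l k] by (simp add: inner_diff_right)
      then show "of_real (p l) * unit_exp (\<xi> k \<bullet> a l)
          = unit_exp (\<xi> k \<bullet> a 1) * (of_real (p l) * unit_exp (tr k (Q * Pl l)))"
        by (simp add: unit_exp_add)
    qed
    then show ?thesis
      unfolding F_def fourier_transform_self_affine[OF assms(4,3), of "\<xi> k"] \<xi>_step t_def
      by (simp add: norm_mult)
  qed
  \<comment> \<open>\<open>\<xi> (- int n)\<close> tends to 0, where the transform is 1, so some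
    \<open>F (- int n)\<close> is positive; finitely many nonzero factors lead from there to index
    0.\<close>
  have F0: "F 0 > 0"
  proof -
    have "(\<lambda>n. F (- int n)) \<longlonglongrightarrow> norm (1 :: complex)"
      unfolding F_def \<xi>_def using assms(4)
      by (intro tendsto_norm fourier_transform_tendsto_1 real_frequency_tendsto_0)
        (auto simp: self_affine_measure_def)
    then have "\<forall>\<^sub>F n in sequentially. F (- int n) > 0" by (intro order_tendstoD) auto
    then obtain n where n: "F (- int n) > 0" by (auto simp: eventually_sequentially)
    have "F (- int n + int j) > 0" for j
    proof (induction j)
      case (Suc j)
      have "F (- int n + int (Suc j)) = t (- int n + int (Suc j)) * F (- int n + int j)"
        by (subst F_step) simp
      then show ?case using Suc t_pos by simp
    qed (use n in simp)
    from this[of n] show ?thesis by simp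
  qed
  obtain \<rho> C where \<rho>: "0 < \<rho>" "\<rho> < 1" "C \<ge> 0" and near: "\<And>n. t (int n) \<ge> 1 - C * \<rho> ^ n"
  proof -
    obtain \<rho> where \<rho>: "0 < \<rho>" "\<rho> < 1" "\<And>r. r \<in># Inner \<Longrightarrow> norm r \<le> \<rho>"
      "\<And>r. r \<in># Outer \<Longrightarrow> inverse (norm r) \<le> \<rho>"
      using ex_contraction_rate by auto
    define c where "c l = (\<Sum>r\<in>#Roots. norm (int_poly_eval (Q * Pl l) r))" for l
    have c: "c l \<ge> 0" for l unfolding c_def by (rule sum_mset_norm_nonneg)
    define C where "C = (\<Sum>l=1..m. c l)"
    have "t (int n) \<ge> (\<Sum>l=1..m. p l) * (1 - 2 * pi * (C * \<rho> ^ n))" for n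
      unfolding t_def
    proof (rule norm_weighted_unit_exp_sum_ge)
      fix l assume l: "l \<in> {1..m}"
      show "p l \<ge> 0" using pos[OF l] by simp
      have "c l \<le> C" unfolding C_def using l c by (intro member_le_sum) auto
      then have "c l * \<rho> ^ n \<le> C * \<rho> ^ n" using \<rho> by (intro mult_right_mono) auto
      moreover obtain N where "N \<in> \<int>" "\<bar>tr (int n) (Q * Pl l) - N\<bar> \<le> c l * \<rho> ^ n"
        using outer_trace_near_int[OF \<rho>, of "int n" "Q * Pl l"] unfolding c_def[symmetric] by auto
      ultimately show "\<exists>N\<in>\<int>. \<bar>tr (int n) (Q * Pl l) - N\<bar> \<le> C * \<rho> ^ n" by (meson order_trans)
    qed
    moreover have "2 * pi * C \<ge> 0" using c by (simp add: C_def sum_nonneg)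
    ultimately show ?thesis using that[of \<rho> "2 * pi * C"] \<rho>(1,2) sum_p by (simp add: mult.assoc)
  qed
  \<comment> \<open>Passing from \<open>n\<close> to \<open>n + 1\<close> uses the factor at
    \<open>n + 1\<close>, which turns the constant \<open>C\<close> into
    \<open>C * \<rho>\<close>.\<close>
  have "\<exists>c>0. \<forall>n. F (int n) \<ge> c"
  proof (rule recursive_product_bounded_below[where t = "\<lambda>n. t (int (Suc n))" and C = "C * \<rho>" and \<rho> = \<rho>])
    show "F (int (Suc n)) = t (int (Suc n)) * F (int n)" for n by (subst F_step) simp
    show "t (int (Suc n)) \<ge> 1 - C * \<rho> * \<rho> ^ n" for n using near[of "Suc n"] by (simp add: mult.assoc)
  qed (use F0 t_pos \<rho> in auto)
  then obtain c where c: "c > 0" "\<And>n. F (int n) \<ge> c" by blast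
  \<comment> \<open>A Rajchman transform is below \<open>c\<close> outside some ball, but along
    \<open>\<xi> (int n)\<close> it is at least \<open>c\<close>; so this sequence is
    bounded.\<close>
  have "\<forall>\<^sub>F \<xi> in at_infinity. norm (fourier_transform \<mu> \<xi>) < c"
    using raj c(1) unfolding rajchman_def by (rule order_tendstoD)
  then obtain R where R: "\<And>\<xi>. norm \<xi> \<ge> R \<Longrightarrow> norm (fourier_transform \<mu> \<xi>) < c"
    by (auto simp: eventually_at_infinity)
  have \<xi>_bound: "norm (\<xi> (int n)) \<le> R" for n
    using R[of "\<xi> (int n)"] c(2)[of n] by (force simp: F_def)
  \<comment> \<open>Bounded frequencies have bounded pairings, so \<open>Q * Pl l\<close> vanishes
    at \<open>\<gamma>\<close>, and \<open>Q\<close> does not.\<close>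
  have Pl_root: "int_poly_eval (Pl l) \<gamma> = 0" if l: "l \<in> {1..m}" for l
  proof -
    have "\<bar>tr (int n) (Q * Pl l)\<bar> \<le> R * norm (a l - a 1)" for n
      unfolding \<xi>_inner[OF l, symmetric]
      by (rule order_trans[OF Cauchy_Schwarz_ineq2 mult_right_mono[OF \<xi>_bound]]) simp
    from root_if_outer_trace_bounded[OF this] show ?thesis using Q(1) by simp
  qed
  \<comment> \<open>Vanishing passes from \<open>\<gamma>\<close> to a conjugate \<open>r\<close>
    outside the disc, so \<open>Z r\<close> annihilates all differences of translations, against
    irreducibility.\<close>
  obtain r where r: "r \<in># Outer" using Outer_nonempty by (meson multiset_nonemptyE)
  have rS: "r \<in> S" by (rule outer_S[OF r])
  have "Z r \<noteq> 0" unfolding Z_def by (rule \<zeta>[OF idx(1)[OF rS]])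
  moreover have "inverse r \<noteq> 0" "inverse r \<noteq> 1" using r by auto
  ultimately obtain l where l: "l \<in> {1..m}" "herm_inner (Z r) (complex_vec (a l - a 1)) \<noteq> 0"
    using irreducible_imp_herm_inner_nonzero[OF IFS assms(2) _ Z_eig[OF rS]] by blast
  have "int_poly_eval (Pl l) r = 0"
    using conjugate[OF Pl_root[OF l(1)]] r by (simp add: in_Roots)
  then show False using l Pl[OF l(1) rS] by simp
qed

end
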